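(* There is no non-constant holomorphic map from a compact Hermitian manifold with positive holomorphic sectional curvature to a Hermitian manifold with non-positive holomorphic sectional curvature. Likewise, there is no non-constant holomorphic map from a compact Hermitian manifold with non-negative holomorphic sectional curvature to a Hermitian manifold with negative holomorphic sectional curvature.
   Context: The holomorphic sectional curvature of a Hermitian manifold $(M,g)$ is taken with respect to the Chern connection: for a nonzero holomorphic tangent vector $v$, $H(v)=R(v,\overline v,v,\overline v)/|v|^4$, where $R_{i\overline{j}k\overline{l}}=-\frac{\partial^{2}g_{k\overline{l}}}{\partial z^{i}\partial \overline{z}^{j}}+g^{p\overline{q}}\frac{\partial g_{k\overline{q}}}{\partial z^{i}}\frac{\partial g_{p\overline{l}}}{\partial \overline{z}^{j}}$ is the Chern curvature tensor in local holomorphic coordinates. A sign condition on the holomorphic sectional curvature means that it holds at every point for every nonzero $v$.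
   Formalization: The compact source manifold is assumed connected (otherwise a map sending different components to different points is a non-constant counterexample), and both manifolds have dimension at least 1. *)

theory Defs
  imports "HOL-Analysis.Analysis"
begin

section \<open>Holomorphic and smooth maps in several complex variables\<close>

definition holomorphic_map_on :: "(complex ^ 'm::finite) set \<Rightarrow> (complex ^ 'm \<Rightarrow> complex ^ 'n::finite) \<Rightarrow> bool"
  where "holomorphic_map_on S f \<longleftrightarrow>
    (\<forall>z\<in>S. \<exists>f'. (f has_derivative f') (at z) \<and> (\<forall>c v. f' (c *s v) = c *s f' v))"

text \<open>Real differentiability of order \<open>k\<close>, and \<open>C\<close>-infinity smoothness; meant for open \<open>S\<close>.\<close>

fun times_cont_diff_on ::
    "nat \<Rightarrow> 'a::real_normed_vector set \<Rightarrow> ('a \<Rightarrow> 'b::real_normed_vector) \<Rightarrow> bool" where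
  "times_cont_diff_on 0 S f \<longleftrightarrow> continuous_on S f"
| "times_cont_diff_on (Suc k) S f \<longleftrightarrow>
     (\<forall>x\<in>S. f differentiable (at x)) \<and>
     (\<forall>v. times_cont_diff_on k S (\<lambda>x. frechet_derivative f (at x) v))"

definition smooth_map_on :: "'a::real_normed_vector set \<Rightarrow> ('a \<Rightarrow> 'b::real_normed_vector) \<Rightarrow> bool"
  where "smooth_map_on S f \<longleftrightarrow> (\<forall>k. times_cont_diff_on k S f)"

text \<open>The Wirtinger operators \<open>\<partial>/\<partial>z\<^sup>i = (\<partial>/\<partial>x\<^sup>i - \<i> \<partial>/\<partial>y\<^sup>i) / 2\<close> and their conjugates.\<close>

definition wirtinger :: "'n::finite \<Rightarrow> (complex ^ 'n \<Rightarrow> complex) \<Rightarrow> complex ^ 'n \<Rightarrow> complex"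
  where "wirtinger i f z =
    (frechet_derivative f (at z) (axis i 1) - \<i> * frechet_derivative f (at z) (axis i \<i>)) / 2"

definition wirtinger_bar :: "'n::finite \<Rightarrow> (complex ^ 'n \<Rightarrow> complex) \<Rightarrow> complex ^ 'n \<Rightarrow> complex"
  where "wirtinger_bar i f z =
    (frechet_derivative f (at z) (axis i 1) + \<i> * frechet_derivative f (at z) (axis i \<i>)) / 2"

section \<open>Complex manifolds\<close>

text \<open>A chart is a coordinate domain together with its coordinate map; only the values of
  the map on the domain matter.\<close>

type_synonym ('a, 'n) chart = "'a set \<times> ('a \<Rightarrow> complex ^ 'n)"

definition chart_inv :: "('a, 'n::finite) chart \<Rightarrow> complex ^ 'n \<Rightarrow> 'a"
  where "chart_inv c = inv_into (fst c) (snd c)"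

definition is_chart :: "'a topology \<Rightarrow> ('a, 'n::finite) chart \<Rightarrow> bool"
  where "is_chart X c \<longleftrightarrow> openin X (fst c) \<and> open (snd c ` fst c) \<and>
    homeomorphic_map (subtopology X (fst c)) (top_of_set (snd c ` fst c)) (snd c)"

definition transition :: "('a, 'n::finite) chart \<Rightarrow> ('a, 'n) chart \<Rightarrow> complex ^ 'n \<Rightarrow> complex ^ 'n"
  where "transition c d = snd d \<circ> chart_inv c"

text \<open>Connectedness is not part of this definition.\<close>

definition complex_manifold :: "'a topology \<Rightarrow> ('a, 'n::finite) chart set \<Rightarrow> bool"
  where "complex_manifold X A \<longleftrightarrow>
    Hausdorff_space X \<and> second_countable X \<and>
    (\<forall>c\<in>A. is_chart X c) \<and> (\<Union>c\<in>A. fst c) = topspace X \<and>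
    (\<forall>c\<in>A. \<forall>d\<in>A. holomorphic_map_on (snd c ` (fst c \<inter> fst d)) (transition c d))"

definition holomorphic_map ::
    "'a topology \<Rightarrow> ('a, 'm::finite) chart set \<Rightarrow> 'b topology \<Rightarrow> ('b, 'n::finite) chart set \<Rightarrow> ('a \<Rightarrow> 'b) \<Rightarrow> bool"
  where "holomorphic_map X A Y B f \<longleftrightarrow> continuous_map X Y f \<and>
    (\<forall>c\<in>A. \<forall>d\<in>B. holomorphic_map_on (snd c ` (fst c \<inter> f -` fst d)) (snd d \<circ> f \<circ> chart_inv c))"

section \<open>Hermitian metrics\<close>

text \<open>The matrix \<open>G\<close> with entries \<open>G $ i $ j = g(\<partial>\<^sub>i, \<partial>\<^sub>j)\<close>, the second index being the
  conjugate one, determines the sesquilinear form \<open>\<Sum> G $ i $ j * v\<^sup>i * cnj w\<^sup>j\<close>.\<close>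

definition herm_form :: "complex ^ 'n::finite ^ 'n \<Rightarrow> complex ^ 'n \<Rightarrow> complex ^ 'n \<Rightarrow> complex"
  where "herm_form G v w = (\<Sum>i\<in>UNIV. \<Sum>j\<in>UNIV. G $ i $ j * v $ i * cnj (w $ j))"

definition herm_norm2 :: "complex ^ 'n::finite ^ 'n \<Rightarrow> complex ^ 'n \<Rightarrow> real"
  where "herm_norm2 G v = Re (herm_form G v v)"

definition hermitian_posdef :: "complex ^ 'n::finite ^ 'n \<Rightarrow> bool"
  where "hermitian_posdef G \<longleftrightarrow>
    (\<forall>i j. G $ j $ i = cnj (G $ i $ j)) \<and> (\<forall>v. v \<noteq> 0 \<longrightarrow> 0 < herm_norm2 G v)"

text \<open>A Hermitian metric is given by its coordinate matrices: \<open>g c z\<close> is the matrix in the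
  chart \<open>c\<close> at the point with coordinates \<open>z\<close>.  The last clause says that these matrices
  describe one form on the holomorphic tangent bundle.\<close>

definition hermitian_metric ::
    "('a, 'n::finite) chart set \<Rightarrow> (('a, 'n) chart \<Rightarrow> complex ^ 'n \<Rightarrow> complex ^ 'n ^ 'n) \<Rightarrow> bool"
  where "hermitian_metric A g \<longleftrightarrow>
    (\<forall>c\<in>A. smooth_map_on (snd c ` fst c) (g c) \<and> (\<forall>z\<in>snd c ` fst c. hermitian_posdef (g c z))) \<and>
    (\<forall>c\<in>A. \<forall>d\<in>A. \<forall>z\<in>snd c ` (fst c \<inter> fst d). \<forall>v w.
       herm_form (g c z) v w =
       herm_form (g d (transition c d z))
         (frechet_derivative (transition c d) (at z) v)
         (frechet_derivative (transition c d) (at z) w))"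

definition hermitian_manifold ::
    "'a topology \<Rightarrow> ('a, 'n::finite) chart set \<Rightarrow>
     (('a, 'n) chart \<Rightarrow> complex ^ 'n \<Rightarrow> complex ^ 'n ^ 'n) \<Rightarrow> bool"
  where "hermitian_manifold X A g \<longleftrightarrow> complex_manifold X A \<and> hermitian_metric A g"

section \<open>Chern curvature and holomorphic sectional curvature\<close>

text \<open>The inverse metric \<open>g\<^sup>p\<^sup>q\<close> (with \<open>q\<close> conjugate) satisfies
  \<open>\<Sum>q. g\<^sup>p\<^sup>q * G $ k $ q = \<delta>\<^sub>k\<^sub>p\<close>, hence it is the \<open>(q, p)\<close> entry of the inverse matrix.\<close>

definition chern_curvature ::
    "(complex ^ 'n::finite \<Rightarrow> complex ^ 'n ^ 'n) \<Rightarrow> complex ^ 'n \<Rightarrow> 'n \<Rightarrow> 'n \<Rightarrow> 'n \<Rightarrow> 'n \<Rightarrow> complex"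
  where "chern_curvature G z i j k l =
    - wirtinger i (wirtinger_bar j (\<lambda>w. G w $ k $ l)) z
    + (\<Sum>p\<in>UNIV. \<Sum>q\<in>UNIV. matrix_inv (G z) $ q $ p
         * wirtinger i (\<lambda>w. G w $ k $ q) z * wirtinger_bar j (\<lambda>w. G w $ p $ l) z)"

text \<open>For a Hermitian metric the sum below, which is \<open>R(v, cnj v, v, cnj v)\<close>, is a real
  number, because the conjugate of \<open>R\<^sub>i\<^sub>j\<^sub>k\<^sub>l\<close> is \<open>R\<^sub>j\<^sub>i\<^sub>l\<^sub>k\<close>; \<open>Re\<close> only changes its type.\<close>

definition hol_sect_curv ::
    "(complex ^ 'n::finite \<Rightarrow> complex ^ 'n ^ 'n) \<Rightarrow> complex ^ 'n \<Rightarrow> complex ^ 'n \<Rightarrow> real"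
  where "hol_sect_curv G z v =
    Re (\<Sum>i\<in>UNIV. \<Sum>j\<in>UNIV. \<Sum>k\<in>UNIV. \<Sum>l\<in>UNIV.
          chern_curvature G z i j k l * v $ i * cnj (v $ j) * v $ k * cnj (v $ l))
    / (herm_norm2 (G z) v)\<^sup>2"

text \<open>\<open>hol_sect_curv_cond P A g\<close>: \<open>P (H v)\<close> holds at every point for every nonzero holomorphic
  tangent vector \<open>v\<close>, the tangent vectors being represented in charts.\<close>

definition hol_sect_curv_cond ::
    "(real \<Rightarrow> bool) \<Rightarrow> ('a, 'n::finite) chart set \<Rightarrow>
     (('a, 'n) chart \<Rightarrow> complex ^ 'n \<Rightarrow> complex ^ 'n ^ 'n) \<Rightarrow> bool"
  where "hol_sect_curv_cond P A g \<longleftrightarrow>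
    (\<forall>c\<in>A. \<forall>z\<in>snd c ` fst c. \<forall>v. v \<noteq> 0 \<longrightarrow> P (hol_sect_curv (g c) z v))"

end

theory Submission
  imports Defs "HOL-Complex_Analysis.Cauchy_Integral_Formula"
begin

text \<open>
  Let \<open>f\<close> be non-constant and let \<open>(x, v)\<close> maximize \<open>|df v|\<^sup>2 / |v|\<^sup>2\<close> over the unit
  tangent vectors of the compact source.  For a holomorphic curve \<open>\<gamma>\<close> with \<open>\<gamma>(0) = x\<close> and
  \<open>\<gamma>'(0) = v\<close> one computes \<open>\<partial>\<partial>\<close>-bar of \<open>|\<gamma>'|\<^sup>2\<close> at \<open>0\<close> to be \<open>|\<gamma>''(0) + \<Gamma>(v, v)|\<^sup>2 - H(v) |v|\<^sup>4\<close>;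
  choosing \<open>\<gamma>''(0) = - \<Gamma>(v, v)\<close> removes the first term.  The same identity for \<open>f \<circ> \<gamma>\<close> gives the lower
  bound \<open>- H(df v) |df v|\<^sup>4\<close>.  Since \<open>|df v|\<^sup>2 |\<gamma>'|\<^sup>2 - |v|\<^sup>2 |(f \<circ> \<gamma>)'|\<^sup>2\<close> has a minimum at \<open>0\<close>,
  it follows that \<open>H(v) |v|\<^sup>2 \<le> H(df v) |df v|\<^sup>2\<close>, which contradicts the sign conditions.
\<close>

section \<open>Wirtinger calculus\<close>

text \<open>Restricting to one holomorphic curve reduces everything to functions of one complex
  variable. No special coordinates are needed, and the torsion of the Chern connection stays
  invisible, because only the symmetric value \<open>\<Gamma>(v, v)\<close> occurs. Comparing a
  difference instead of a quotient or its logarithm asks nothing of the mixed derivative beyond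
  linearity. The two accelerations behave differently: that of \<gamma> is free, while that of the
  image curve is forced by the map, but its square has the favourable sign. The inequality at the
  maximum must hold in a full neighbourhood of x. Compactness in coordinates yields maxima over
  closed balls, possibly attained on the boundary, so a largest one over a finite cover has to be
  selected. A maximal value 0 would make the differential vanish identically, and connectedness
  would make the map constant. Holomorphy is given as pointwise complex linearity of the real
  derivative. Continuity of the differential and the higher derivatives of the image curve therefore
  come from Cauchy's theory in one variable.\<close>

lemma frechet_derivative_wirtinger:
  fixes f :: "complex ^ 'n::finite \<Rightarrow> complex"
  assumes "f differentiable (at z)"
  shows "frechet_derivative f (at z) v =
    (\<Sum>j\<in>UNIV. wirtinger j f z * v $ j + wirtinger_bar j f z * cnj (v $ j))"
proof -
  let ?L = "frechet_derivative f (at z)"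
  have lin: "linear ?L"
    by (rule linear_frechet_derivative[OF assms])
  \<comment> \<open>Expansion in the real basis \<open>axis j 1\<close>, \<open>axis j \<i>\<close>:
    the derivative is only real linear, and the Wirtinger coefficients collect its complex linear
    and conjugate linear parts.\<close>
  have v: "v = (\<Sum>j\<in>UNIV. Re (v $ j) *\<^sub>R axis j 1 + Im (v $ j) *\<^sub>R axis j \<i>)"
  proof -
    have "(\<Sum>j\<in>UNIV. Re (v $ j) *\<^sub>R axis j 1 + Im (v $ j) *\<^sub>R axis j \<i>) $ k =
        (\<Sum>j\<in>UNIV. if j = k then v $ k else 0)" for k
      unfolding sum_component by (rule sum.cong) (auto simp: axis_def complex_eq_iff)
    then show ?thesis by (simp add: vec_eq_iff)
  qed
  have "?L v = ?L (\<Sum>j\<in>UNIV. Re (v $ j) *\<^sub>R axis j 1 + Im (v $ j) *\<^sub>R axis j \<i>)"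
    using v by simp
  also have "\<dots> = (\<Sum>j\<in>UNIV. Re (v $ j) *\<^sub>R ?L (axis j 1) + Im (v $ j) *\<^sub>R ?L (axis j \<i>))"
    by (simp add: linear_sum[OF lin] linear_add[OF lin] linear_scale[OF lin])
  also have "\<dots> = (\<Sum>j\<in>UNIV. wirtinger j f z * v $ j + wirtinger_bar j f z * cnj (v $ j))"
    by (rule sum.cong) (auto simp: wirtinger_def wirtinger_bar_def complex_eq_iff field_simps)
  finally show ?thesis .
qed

lemma has_derivative_vec_of_field:
  fixes \<delta> :: "complex \<Rightarrow> complex ^ 'n::finite"
  assumes "\<And>k. ((\<lambda>t. \<delta> t $ k) has_field_derivative e $ k) (at t)"
  shows "(\<delta> has_derivative (\<lambda>h. h *s e)) (at t)"
proof (rule has_derivative_componentwise_within[THEN iffD2], intro ballI)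
  fix i :: "complex ^ 'n" assume "i \<in> Basis"
  then obtain k u where i: "i = axis k u" by (auto simp: Basis_vec_def)
  have "((\<lambda>t. \<delta> t $ k) has_derivative (\<lambda>h. h * e $ k)) (at t)"
    using assms[of k] by (simp add: has_field_derivative_def mult_commute_abs)
  from bounded_linear.has_derivative[OF bounded_linear_inner_left this, of u]
  show "((\<lambda>x. \<delta> x \<bullet> i) has_derivative (\<lambda>x. (x *s e) \<bullet> i)) (at t)"
    by (simp add: i inner_axis)
qed

text \<open>The differential of the curve is the complex linear map sending \<open>h\<close> to
  \<open>h *s e\<close>, so it respects the splitting of the derivative of \<open>\<phi>\<close>
  into a part linear in \<open>h\<close> and a part linear in \<open>cnj h\<close>.\<close>

lemma has_derivative_wirtinger_chain:
  fixes \<phi> :: "complex ^ 'n::finite \<Rightarrow> complex"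
  assumes "\<phi> differentiable (at (\<delta> t))"
    and "\<And>k. ((\<lambda>t. \<delta> t $ k) has_field_derivative e $ k) (at t)"
  shows "((\<lambda>t. \<phi> (\<delta> t)) has_derivative
    (\<lambda>h. (\<Sum>j\<in>UNIV. wirtinger j \<phi> (\<delta> t) * e $ j) * h
       + (\<Sum>j\<in>UNIV. wirtinger_bar j \<phi> (\<delta> t) * cnj (e $ j)) * cnj h)) (at t)"
proof -
  have 1: "(\<phi> has_derivative frechet_derivative \<phi> (at (\<delta> t))) (at (\<delta> t))"
    using assms(1) frechet_derivative_works by blast
  have "((\<lambda>t. \<phi> (\<delta> t)) has_derivative (\<lambda>h. frechet_derivative \<phi> (at (\<delta> t)) (h *s e))) (at t)"
    by (rule has_derivative_compose[OF has_derivative_vec_of_field[OF assms(2)] 1])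
  then show ?thesis
    by (simp add: frechet_derivative_wirtinger[OF assms(1)] sum.distrib sum_distrib_right sum_distrib_left mult_ac)
qed

lemma component_differentiable:
  fixes G :: "complex ^ 'n::finite \<Rightarrow> complex ^ 'n ^ 'n"
  assumes "G differentiable (at z)"
  shows "(\<lambda>w. G w $ k $ l) differentiable (at z)"
    and "frechet_derivative (\<lambda>w. G w $ k $ l) (at z) = (\<lambda>v. frechet_derivative G (at z) v $ k $ l)"
proof -
  have "(G has_derivative frechet_derivative G (at z)) (at z)"
    using assms frechet_derivative_works by blast
  from bounded_linear.has_derivative[OF bounded_linear_vec_nth,
      OF bounded_linear.has_derivative[OF bounded_linear_vec_nth this, of k], of l]
  have *: "((\<lambda>w. G w $ k $ l) has_derivative (\<lambda>v. frechet_derivative G (at z) v $ k $ l)) (at z)" .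
  show "(\<lambda>w. G w $ k $ l) differentiable (at z)" using * differentiable_def by blast
  show "frechet_derivative (\<lambda>w. G w $ k $ l) (at z) = (\<lambda>v. frechet_derivative G (at z) v $ k $ l)"
    using frechet_derivative_at[OF *] by simp
qed

lemma smooth_map_on_differentiable:
  assumes "smooth_map_on U G" and "z \<in> U"
  shows "G differentiable (at z)"
    and "(\<lambda>x. frechet_derivative G (at x) v) differentiable (at z)"
proof -
  have "times_cont_diff_on (Suc (Suc 0)) U G" using assms smooth_map_on_def by blast
  then show "G differentiable (at z)"
    "(\<lambda>x. frechet_derivative G (at x) v) differentiable (at z)"
    using assms(2) by auto
qed

text \<open>A Wirtinger derivative is a fixed combination of two directional derivatives, each
  differentiable by smoothness of order two. Passing from entries of the derivative to derivatives
  of entries is justified on \<open>U\<close>, whence the transfer along an open set.\<close>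

lemma differentiable_wirtinger_bar:
  fixes G :: "complex ^ 'n::finite \<Rightarrow> complex ^ 'n ^ 'n"
  assumes "open U" and "smooth_map_on U G" and "z \<in> U"
  shows "wirtinger_bar j (\<lambda>w. G w $ k $ l) differentiable (at z)"
proof -
  let ?D = "\<lambda>v x. frechet_derivative G (at x) v $ k $ l"
  have d: "?D v differentiable (at z)" for v
  proof -
    have "((\<lambda>x. frechet_derivative G (at x) v) has_derivative
        frechet_derivative (\<lambda>x. frechet_derivative G (at x) v) (at z)) (at z)"
      using smooth_map_on_differentiable(2)[OF assms(2,3)] frechet_derivative_works by blast
    from bounded_linear.has_derivative[OF bounded_linear_vec_nth,
        OF bounded_linear.has_derivative[OF bounded_linear_vec_nth this, of k], of l]
    show ?thesis unfolding differentiable_def by blast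
  qed
  have "(\<lambda>x. (?D (axis j 1) x + \<i> * ?D (axis j \<i>) x) / 2) differentiable (at z)"
    by (intro derivative_intros d differentiable_divide) auto
  then obtain L where "((\<lambda>x. (?D (axis j 1) x + \<i> * ?D (axis j \<i>) x) / 2) has_derivative L) (at z)"
    unfolding differentiable_def by blast
  then have "(wirtinger_bar j (\<lambda>w. G w $ k $ l) has_derivative L) (at z)"
    by (rule has_derivative_transform_within_open[OF _ assms(1,3)])
      (simp add: wirtinger_bar_def component_differentiable[OF smooth_map_on_differentiable(1)[OF assms(2)]])
  then show ?thesis unfolding differentiable_def by blast
qed

text \<open>Conjugation exchanges the complex linear and the conjugate linear part of a derivative,
  and Hermitian symmetry identifies the conjugate of the entry \<open>(l, p)\<close> with the entry
  \<open>(p, l)\<close> on a whole neighbourhood, so the two may be differentiated alike.\<close>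

lemma cnj_wirtinger:
  fixes G :: "complex ^ 'n::finite \<Rightarrow> complex ^ 'n ^ 'n"
  assumes "open U" and "smooth_map_on U G" and "z \<in> U" and "\<And>z. z \<in> U \<Longrightarrow> hermitian_posdef (G z)"
  shows "wirtinger_bar j (\<lambda>w. G w $ p $ l) z = cnj (wirtinger j (\<lambda>w. G w $ l $ p) z)"
proof -
  have "((\<lambda>w. G w $ l $ p) has_derivative frechet_derivative (\<lambda>w. G w $ l $ p) (at z)) (at z)"
    using component_differentiable(1)[OF smooth_map_on_differentiable(1)[OF assms(2,3)]]
      frechet_derivative_works by blast
  then have "((\<lambda>w. cnj (G w $ l $ p)) has_derivative
      (\<lambda>v. cnj (frechet_derivative (\<lambda>w. G w $ l $ p) (at z) v))) (at z)"
    by (rule bounded_linear.has_derivative[OF bounded_linear_cnj])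
  then have "((\<lambda>w. G w $ p $ l) has_derivative
      (\<lambda>v. cnj (frechet_derivative (\<lambda>w. G w $ l $ p) (at z) v))) (at z)"
    by (rule has_derivative_transform_within_open[OF _ assms(1,3)])
      (use assms(4) in \<open>metis hermitian_posdef_def\<close>)
  from frechet_derivative_at[OF this, symmetric] show ?thesis
    by (simp add: wirtinger_def wirtinger_bar_def fun_eq_iff)
qed

section \<open>Wirtinger derivatives in one complex variable\<close>

definition has_wirtinger_derivs :: "(complex \<Rightarrow> complex) \<Rightarrow> complex \<Rightarrow> complex \<Rightarrow> complex \<Rightarrow> bool"
  where "has_wirtinger_derivs f X Y t \<longleftrightarrow> (f has_derivative (\<lambda>h. X * h + Y * cnj h)) (at t)"

text \<open>The product rule for the z-derivative requires real differentiability. The existential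
  \<open>Y\<close> keeps that information and drops the value, so the rules below compute one
  coefficient only.\<close>

definition has_dz :: "(complex \<Rightarrow> complex) \<Rightarrow> complex \<Rightarrow> complex \<Rightarrow> bool"
  where "has_dz f X t \<longleftrightarrow> (\<exists>Y. has_wirtinger_derivs f X Y t)"

lemma has_wirtinger_derivs_add:
  assumes "has_wirtinger_derivs f X Y t" and "has_wirtinger_derivs g Z W t"
  shows "has_wirtinger_derivs (\<lambda>t. f t + g t) (X + Z) (Y + W) t"
  using has_derivative_add[OF assms[unfolded has_wirtinger_derivs_def]]
  by (simp add: has_wirtinger_derivs_def algebra_simps)

lemma has_wirtinger_derivs_mult:
  assumes "has_wirtinger_derivs f X Y t" and "has_wirtinger_derivs g Z W t"
  shows "has_wirtinger_derivs (\<lambda>t. f t * g t) (f t * Z + X * g t) (f t * W + Y * g t) t"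
  using has_derivative_mult[OF assms[unfolded has_wirtinger_derivs_def]]
  by (simp add: has_wirtinger_derivs_def algebra_simps)

lemma has_wirtinger_derivs_sum:
  assumes "\<And>i. i \<in> I \<Longrightarrow> has_wirtinger_derivs (f i) (X i) (Y i) t"
  shows "has_wirtinger_derivs (\<lambda>t. \<Sum>i\<in>I. f i t) (\<Sum>i\<in>I. X i) (\<Sum>i\<in>I. Y i) t"
  using has_derivative_sum[of I f "\<lambda>i h. X i * h + Y i * cnj h" "at t"] assms
  by (simp add: has_wirtinger_derivs_def sum.distrib sum_distrib_right)

lemma has_wirtinger_derivs_cnj:
  assumes "has_wirtinger_derivs f X Y t"
  shows "has_wirtinger_derivs (\<lambda>t. cnj (f t)) (cnj Y) (cnj X) t"
  using bounded_linear.has_derivative[OF bounded_linear_cnj assms[unfolded has_wirtinger_derivs_def]]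
  by (simp add: has_wirtinger_derivs_def algebra_simps)

lemma has_dz_add:
  "has_dz f X t \<Longrightarrow> has_dz g Z t \<Longrightarrow> has_dz (\<lambda>t. f t + g t) (X + Z) t"
  unfolding has_dz_def using has_wirtinger_derivs_add by blast

lemma has_dz_mult:
  "has_dz f X t \<Longrightarrow> has_dz g Z t \<Longrightarrow> has_dz (\<lambda>t. f t * g t) (f t * Z + X * g t) t"
  unfolding has_dz_def using has_wirtinger_derivs_mult by blast

lemma has_dz_sum:
  assumes "\<And>i. i \<in> I \<Longrightarrow> has_dz (f i) (X i) t"
  shows "has_dz (\<lambda>t. \<Sum>i\<in>I. f i t) (\<Sum>i\<in>I. X i) t"
proof -
  obtain Y where "\<And>i. i \<in> I \<Longrightarrow> has_wirtinger_derivs (f i) (X i) (Y i) t"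
    using assms unfolding has_dz_def by metis
  then show ?thesis unfolding has_dz_def using has_wirtinger_derivs_sum by blast
qed

lemma has_dz_holomorphic:
  assumes "(f has_field_derivative X) (at t)"
  shows "has_dz f X t" and "has_dz (\<lambda>t. cnj (f t)) 0 t"
proof -
  have "has_wirtinger_derivs f X 0 t"
    using assms by (simp add: has_wirtinger_derivs_def has_field_derivative_def)
  from this has_wirtinger_derivs_cnj[OF this] show "has_dz f X t" "has_dz (\<lambda>t. cnj (f t)) 0 t"
    unfolding has_dz_def by auto
qed

lemma has_dz_chain:
  fixes \<phi> :: "complex ^ 'n::finite \<Rightarrow> complex"
  assumes "\<phi> differentiable (at (\<delta> t))"
    and "\<And>k. ((\<lambda>t. \<delta> t $ k) has_field_derivative e $ k) (at t)"
  shows "has_dz (\<lambda>t. \<phi> (\<delta> t)) (\<Sum>j\<in>UNIV. wirtinger j \<phi> (\<delta> t) * e $ j) t"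
  using has_derivative_wirtinger_chain[OF assms]
  unfolding has_dz_def has_wirtinger_derivs_def by blast

section \<open>Hermitian forms and the squared norm of a velocity\<close>

lemma hermitian_posdef_cnj:
  assumes "hermitian_posdef G"
  shows "cnj (G $ i $ j) = G $ j $ i"
  using assms unfolding hermitian_posdef_def by metis

lemma herm_form_cnj:
  assumes "hermitian_posdef G"
  shows "herm_form G w v = cnj (herm_form G v w)"
proof -
  have "cnj (herm_form G v w) = (\<Sum>i\<in>UNIV. \<Sum>j\<in>UNIV. G $ j $ i * cnj (v $ i) * w $ j)"
    by (simp add: herm_form_def hermitian_posdef_cnj[OF assms])
  also have "\<dots> = herm_form G w v"
    unfolding herm_form_def by (subst sum.swap) (simp add: mult_ac)
  finally show ?thesis by simp
qed

lemma herm_form_real: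
  assumes "hermitian_posdef G"
  shows "herm_form G v v = of_real (herm_norm2 G v)"
  using herm_form_cnj[OF assms, of v v] by (simp add: herm_norm2_def complex_eq_iff)

text \<open>The imaginary part is constantly 0, so its differential vanishes. Evaluating this at 1
  and \<i> forces the two Wirtinger derivatives to be conjugate.\<close>

lemma has_dz_real_valued:
  assumes "has_dz (\<lambda>t. of_real (P t)) A t"
  shows "(P has_derivative (\<lambda>h. 2 * Re (A * h))) (at t)"
proof -
  obtain B where B: "((\<lambda>t. complex_of_real (P t)) has_derivative (\<lambda>h. A * h + B * cnj h)) (at t)"
    using assms unfolding has_dz_def has_wirtinger_derivs_def by blast
  have "((\<lambda>t. Im (of_real (P t))) has_derivative (\<lambda>h. Im (A * h + B * cnj h))) (at t)"
    by (rule bounded_linear.has_derivative[OF bounded_linear_Im B])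
  then have "((\<lambda>t. 0) has_derivative (\<lambda>h. Im (A * h + B * cnj h))) (at t)" by simp
  from has_derivative_unique[OF this has_derivative_const]
  have *: "Im (A * h + B * cnj h) = 0" for h by metis
  have "B = cnj A" using *[of 1] *[of \<i>] by (simp add: complex_eq_iff)
  moreover have "((\<lambda>t. Re (of_real (P t))) has_derivative (\<lambda>h. Re (A * h + B * cnj h))) (at t)"
    by (rule bounded_linear.has_derivative[OF bounded_linear_Re B])
  ultimately show ?thesis by (simp add: algebra_simps)
qed

lemma herm_norm2_zero: "herm_norm2 G 0 = 0"
  by (simp add: herm_norm2_def herm_form_def)

lemma herm_norm2_pos: "hermitian_posdef G \<Longrightarrow> v \<noteq> 0 \<Longrightarrow> 0 < herm_norm2 G v"
  unfolding hermitian_posdef_def by blast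

lemma herm_norm2_nonneg: "hermitian_posdef G \<Longrightarrow> 0 \<le> herm_norm2 G v"
  using herm_norm2_pos[of G v] by (cases "v = 0") (simp_all add: herm_norm2_zero)

text \<open>The mixed derivative at \<open>0\<close> of the squared norm of the velocity of a holomorphic curve
  through \<open>z\<close> with velocity \<open>v\<close> and acceleration \<open>a\<close>.\<close>

definition dz_dzbar_metric ::
    "(complex ^ 'n::finite \<Rightarrow> complex ^ 'n ^ 'n) \<Rightarrow> complex ^ 'n \<Rightarrow> complex ^ 'n \<Rightarrow> complex ^ 'n \<Rightarrow> complex"
  where "dz_dzbar_metric G z v a = (\<Sum>k\<in>UNIV. \<Sum>l\<in>UNIV.
      (\<Sum>j\<in>UNIV. \<Sum>i\<in>UNIV. wirtinger i (wirtinger_bar j (\<lambda>w. G w $ k $ l)) z * v $ i * cnj (v $ j))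
        * v $ k * cnj (v $ l)
    + (\<Sum>j\<in>UNIV. wirtinger_bar j (\<lambda>w. G w $ k $ l) z * cnj (v $ j)) * a $ k * cnj (v $ l)
    + (\<Sum>i\<in>UNIV. wirtinger i (\<lambda>w. G w $ k $ l) z * v $ i) * v $ k * cnj (a $ l)
    + G z $ k $ l * a $ k * cnj (a $ l))"

text \<open>\<open>Y\<close> is the derivative of the squared norm in \<open>cnj t\<close>. Since
  \<open>\<delta>\<close>, \<open>e\<close> and \<open>a\<close> are holomorphic where they are
  differentiated, each derivative falls on the metric and on just one of the velocity factors. The
  assumption on \<open>b\<close> makes \<open>cnj (a t $ l)\<close> differentiable at 0, with
  z-derivative 0.\<close>

lemma herm_norm2_along_curve:
  fixes G :: "complex ^ 'n::finite \<Rightarrow> complex ^ 'n ^ 'n"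
  assumes U: "open U" "smooth_map_on U G" "\<And>z. z \<in> U \<Longrightarrow> hermitian_posdef (G z)"
    and r: "0 < r" and \<delta>U: "\<And>t. t \<in> ball 0 r \<Longrightarrow> \<delta> t \<in> U"
    and \<delta>: "\<And>t k. t \<in> ball 0 r \<Longrightarrow> ((\<lambda>s. \<delta> s $ k) has_field_derivative e t $ k) (at t)"
    and e: "\<And>t k. t \<in> ball 0 r \<Longrightarrow> ((\<lambda>s. e s $ k) has_field_derivative a t $ k) (at t)"
    and a: "\<And>k. ((\<lambda>s. a s $ k) has_field_derivative b $ k) (at 0)"
  obtains Y where
    "\<And>t. t \<in> ball 0 r \<Longrightarrow>
      ((\<lambda>t. herm_norm2 (G (\<delta> t)) (e t)) has_derivative (\<lambda>h. 2 * Re (cnj (Y t) * h))) (at t)"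
    and "has_dz Y (dz_dzbar_metric G (\<delta> 0) (e 0) (a 0)) 0"
proof
  define Y where "Y t = (\<Sum>k\<in>UNIV. \<Sum>l\<in>UNIV.
      (\<Sum>j\<in>UNIV. wirtinger_bar j (\<lambda>w. G w $ k $ l) (\<delta> t) * cnj (e t $ j)) * e t $ k * cnj (e t $ l)
      + G (\<delta> t) $ k $ l * e t $ k * cnj (a t $ l))" for t
  have dG: "(\<lambda>w. G w $ k $ l) differentiable (at (\<delta> t))" if "t \<in> ball 0 r" for t k l
    using component_differentiable(1)[OF smooth_map_on_differentiable(1)[OF U(2) \<delta>U[OF that]]] .
  show "((\<lambda>t. herm_norm2 (G (\<delta> t)) (e t)) has_derivative (\<lambda>h. 2 * Re (cnj (Y t) * h))) (at t)"
    if t: "t \<in> ball 0 r" for t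
  proof -
    \<comment> \<open>This unsimplified shape is what \<open>has_dz_sum\<close> and
      \<open>has_dz_mult\<close> produce literally; the factor 0 is the z-derivative of the
      conjugated velocity.\<close>
    let ?A = "\<Sum>k\<in>UNIV. \<Sum>l\<in>UNIV.
        G (\<delta> t) $ k $ l * e t $ k * 0
        + (G (\<delta> t) $ k $ l * a t $ k + (\<Sum>j\<in>UNIV. wirtinger j (\<lambda>w. G w $ k $ l) (\<delta> t) * e t $ j) * e t $ k)
          * cnj (e t $ l)"
    have 1: "has_dz (\<lambda>t. herm_form (G (\<delta> t)) (e t) (e t)) ?A t"
      unfolding herm_form_def
      by (intro has_dz_sum has_dz_mult has_dz_holomorphic[OF e] has_dz_chain dG \<delta> t)
    have 2: "?A = cnj (Y t)"
    proof -
      have "cnj (Y t) = (\<Sum>k\<in>UNIV. \<Sum>l\<in>UNIV.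
        (\<Sum>j\<in>UNIV. wirtinger j (\<lambda>w. G w $ l $ k) (\<delta> t) * e t $ j) * cnj (e t $ k) * e t $ l
        + G (\<delta> t) $ l $ k * cnj (e t $ k) * a t $ l)"
        by (simp add: Y_def cnj_wirtinger[OF U(1,2) \<delta>U[OF t] U(3)]
            hermitian_posdef_cnj[OF U(3)[OF \<delta>U[OF t]]])
      also have "\<dots> = ?A"
        by (subst sum.swap) (simp add: algebra_simps)
      finally show ?thesis by simp
    qed
    from 1 2 have "has_dz (\<lambda>t. herm_form (G (\<delta> t)) (e t) (e t)) (cnj (Y t)) t" by simp
    then obtain B where "((\<lambda>t. herm_form (G (\<delta> t)) (e t) (e t)) has_derivative (\<lambda>h. cnj (Y t) * h + B * cnj h)) (at t)"
      unfolding has_dz_def has_wirtinger_derivs_def by blast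
    then have "((\<lambda>t. of_real (herm_norm2 (G (\<delta> t)) (e t))) has_derivative (\<lambda>h. cnj (Y t) * h + B * cnj h)) (at t)"
      by (rule has_derivative_transform_within_open[where s = "ball 0 r"])
        (use t in \<open>auto intro!: herm_form_real U(3) \<delta>U\<close>)
    then show ?thesis
      by (intro has_dz_real_valued) (auto simp: has_dz_def has_wirtinger_derivs_def)
  qed
  have z: "0 \<in> ball (0::complex) r" using r by simp
  have dB: "wirtinger_bar j (\<lambda>w. G w $ k $ l) differentiable (at (\<delta> 0))" for j k l
    by (rule differentiable_wirtinger_bar[OF U(1,2) \<delta>U[OF z]])
  have "has_dz Y (\<Sum>k\<in>UNIV. \<Sum>l\<in>UNIV.
     ((\<Sum>j\<in>UNIV. wirtinger_bar j (\<lambda>w. G w $ k $ l) (\<delta> 0) * cnj (e 0 $ j)) * e 0 $ k * 0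
      + ((\<Sum>j\<in>UNIV. wirtinger_bar j (\<lambda>w. G w $ k $ l) (\<delta> 0) * cnj (e 0 $ j)) * a 0 $ k
        + (\<Sum>j\<in>UNIV. wirtinger_bar j (\<lambda>w. G w $ k $ l) (\<delta> 0) * 0
            + (\<Sum>i\<in>UNIV. wirtinger i (wirtinger_bar j (\<lambda>w. G w $ k $ l)) (\<delta> 0) * e 0 $ i) * cnj (e 0 $ j)) * e 0 $ k)
        * cnj (e 0 $ l))
     + (G (\<delta> 0) $ k $ l * e 0 $ k * 0
        + (G (\<delta> 0) $ k $ l * a 0 $ k + (\<Sum>j\<in>UNIV. wirtinger j (\<lambda>w. G w $ k $ l) (\<delta> 0) * e 0 $ j) * e 0 $ k)
          * cnj (a 0 $ l))) 0" (is "has_dz Y ?M 0")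
    unfolding Y_def
    by (intro has_dz_sum has_dz_add has_dz_mult has_dz_holomorphic[OF e] has_dz_holomorphic[OF a]
        has_dz_chain dG dB \<delta> z)
  moreover have "?M = dz_dzbar_metric G (\<delta> 0) (e 0) (a 0)"
    unfolding dz_dzbar_metric_def by (intro sum.cong refl) (simp add: ring_distribs sum_distrib_right)
  ultimately show "has_dz Y (dz_dzbar_metric G (\<delta> 0) (e 0) (a 0)) 0" by simp
qed

section \<open>Chern curvature along holomorphic curves\<close>

lemma second_derivative_nonneg_at_min:
  fixes p q :: "real \<Rightarrow> real"
  assumes r: "0 < r" and p: "\<And>s. \<bar>s\<bar> < r \<Longrightarrow> (p has_real_derivative q s) (at s)"
    and q: "(q has_real_derivative L) (at 0)" and min: "\<And>s. \<bar>s\<bar> < r \<Longrightarrow> p 0 \<le> p s"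
  shows "0 \<le> L"
proof (rule ccontr)
  assume "\<not> 0 \<le> L"
  have q0: "q 0 = 0"
    by (rule DERIV_local_min[OF p r]) (use r min in auto)
  obtain d where d: "d > 0" "\<And>h. 0 < h \<Longrightarrow> h < d \<Longrightarrow> q (0 + h) < q 0"
    using DERIV_neg_dec_right[OF q] \<open>\<not> 0 \<le> L\<close> by auto
  \<comment> \<open>Halving keeps \<open>s\<close> strictly below both radii, so the mean value
    point between 0 and \<open>s\<close> lies where \<open>q\<close> is already negative, and
    \<open>p s\<close> falls below the minimum.\<close>
  define s where "s = min d r / 2"
  have s: "0 < s" "s < d" "s < r" using d(1) r by (auto simp: s_def min_def)
  have "\<exists>x>0. x < s \<and> p s - p 0 = (s - 0) * q x"
    by (rule MVT2) (use s p in auto)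
  then obtain x where x: "0 < x" "x < s" "p s - p 0 = s * q x" by auto
  have "q x < 0" using d(2)[of x] x s q0 by simp
  then have "p s - p 0 < 0" using x s by (simp add: mult_pos_neg)
  then show False using min[of s] s by simp
qed

text \<open>\<open>m\<close> is the mixed derivative of \<open>P\<close> at \<open>0\<close>.  For real-valued \<open>P\<close> the two first order
  Wirtinger derivatives are conjugate, so \<open>Y\<close>, the derivative in \<open>cnj t\<close>, determines the differential.\<close>

definition has_dz_dzbar :: "real \<Rightarrow> (complex \<Rightarrow> real) \<Rightarrow> real \<Rightarrow> bool"
  where "has_dz_dzbar r P m \<longleftrightarrow> (\<exists>Y M.
    (\<forall>t\<in>ball 0 r. (P has_derivative (\<lambda>h. 2 * Re (cnj (Y t) * h))) (at t)) \<and>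
    has_dz Y M 0 \<and> Re M = m)"

lemma has_dz_dzbar_linear:
  assumes "has_dz_dzbar r P m" and "has_dz_dzbar r Q n"
  shows "has_dz_dzbar r (\<lambda>t. q * P t - p * Q t) (q * m - p * n)"
proof -
  obtain Y1 M1 where 1: "\<And>t. t \<in> ball 0 r \<Longrightarrow> (P has_derivative (\<lambda>h. 2 * Re (cnj (Y1 t) * h))) (at t)"
    "has_dz Y1 M1 0" "Re M1 = m" using assms(1) unfolding has_dz_dzbar_def by blast
  obtain Y2 M2 where 2: "\<And>t. t \<in> ball 0 r \<Longrightarrow> (Q has_derivative (\<lambda>h. 2 * Re (cnj (Y2 t) * h))) (at t)"
    "has_dz Y2 M2 0" "Re M2 = n" using assms(2) unfolding has_dz_dzbar_def by blast
  let ?Y = "\<lambda>t. of_real q * Y1 t + of_real (- p) * Y2 t"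
  let ?M = "of_real q * M1 + of_real (- p) * M2"
  have "\<forall>t\<in>ball 0 r. ((\<lambda>t. q * P t - p * Q t) has_derivative (\<lambda>h. 2 * Re (cnj (?Y t) * h))) (at t)"
  proof
    fix t :: complex assume t: "t \<in> ball 0 r"
    have "((\<lambda>t. q * P t - p * Q t) has_derivative
        (\<lambda>h. q * (2 * Re (cnj (Y1 t) * h)) - p * (2 * Re (cnj (Y2 t) * h)))) (at t)"
      by (intro has_derivative_diff has_derivative_mult_right 1 2 t)
    then show "((\<lambda>t. q * P t - p * Q t) has_derivative (\<lambda>h. 2 * Re (cnj (?Y t) * h))) (at t)"
      by (simp add: algebra_simps)
  qed
  moreover have "has_dz ?Y ?M 0"
  proof -
    have "has_dz ?Y (of_real q * M1 + 0 * Y1 0 + (of_real (- p) * M2 + 0 * Y2 0)) 0"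
      by (intro has_dz_add has_dz_mult has_dz_holomorphic(1) DERIV_const 1 2)
    then show ?thesis by simp
  qed
  moreover have "Re ?M = q * m - p * n" using 1 2 by simp
  ultimately show ?thesis
    unfolding has_dz_dzbar_def by (intro exI[of _ ?Y] exI[of _ ?M] conjI)
qed

text \<open>With \<open>N\<close> the derivative of \<open>Y\<close> in \<open>cnj t\<close>, the
  second derivatives of \<open>P\<close> along the real and the imaginary axis are
  \<open>2 * Re (M + N)\<close> and \<open>2 * Re (M - N)\<close>. Both are nonnegative at a
  minimum, and \<open>N\<close> cancels in their sum, the Laplacian \<open>4 * m\<close>.\<close>

lemma has_dz_dzbar_nonneg_at_min:
  fixes P :: "complex \<Rightarrow> real"
  assumes r: "0 < r" and "has_dz_dzbar r P m" and min: "\<And>t. t \<in> ball 0 r \<Longrightarrow> P 0 \<le> P t"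
  shows "0 \<le> m"
proof -
  obtain Y M where D: "\<And>t. t \<in> ball 0 r \<Longrightarrow> (P has_derivative (\<lambda>h. 2 * Re (cnj (Y t) * h))) (at t)"
    and Y: "has_dz Y M 0" and M: "Re M = m"
    using assms(2) unfolding has_dz_dzbar_def by blast
  obtain N where N: "(Y has_derivative (\<lambda>h. M * h + N * cnj h)) (at 0)"
    using Y unfolding has_dz_def has_wirtinger_derivs_def by blast
  have *: "0 \<le> 2 * Re (cnj (M * u + N * cnj u) * u)" if u: "norm u = 1" for u
  proof (rule second_derivative_nonneg_at_min[OF r])
    have lin: "((\<lambda>s. of_real s * u) has_derivative (\<lambda>h. of_real h * u)) (at s)" for s
      by (auto intro!: derivative_eq_intros)
    fix s :: real assume s: "\<bar>s\<bar> < r"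
    then have su: "of_real s * u \<in> ball 0 r" using u by (simp add: norm_mult)
    have "((\<lambda>s. P (of_real s * u)) has_derivative
        (\<lambda>h. 2 * Re (cnj (Y (of_real s * u)) * (of_real h * u)))) (at s)"
      by (rule has_derivative_compose[OF lin D[OF su]])
    then show "((\<lambda>s. P (of_real s * u)) has_real_derivative
        2 * Re (cnj (Y (of_real s * u)) * u)) (at s)"
      by (rule has_derivative_imp_has_field_derivative) (simp add: algebra_simps)
    show "P (of_real 0 * u) \<le> P (of_real s * u)" using min[OF su] by simp
  next
    have "((\<lambda>s. of_real s * u) has_derivative (\<lambda>h. of_real h * u)) (at 0)"
      by (auto intro!: derivative_eq_intros)
    from has_derivative_compose[OF this, of Y "\<lambda>h. M * h + N * cnj h"] N
    have "((\<lambda>s. Y (of_real s * u)) has_derivative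
        (\<lambda>h. M * (of_real h * u) + N * cnj (of_real h * u))) (at 0)" by simp
    then have "((\<lambda>s. 2 * Re (cnj (Y (of_real s * u)) * u)) has_derivative
        (\<lambda>h. 2 * Re (cnj (M * (of_real h * u) + N * cnj (of_real h * u)) * u))) (at 0)"
      by (intro has_derivative_mult_right bounded_linear.has_derivative[OF bounded_linear_Re]
          has_derivative_mult_left bounded_linear.has_derivative[OF bounded_linear_cnj])
    then show "((\<lambda>s. 2 * Re (cnj (Y (of_real s * u)) * u)) has_real_derivative
        2 * Re (cnj (M * u + N * cnj u) * u)) (at 0)"
      by (rule has_derivative_imp_has_field_derivative) (simp add: algebra_simps)
  qed
  show ?thesis using *[of 1] *[of \<i>] M by (simp add: algebra_simps)
qed

section \<open>The curvature identity\<close>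

lemma herm_form_add:
  "herm_form G (u + v) w = herm_form G u w + herm_form G v w"
  "herm_form G w (u + v) = herm_form G w u + herm_form G w v"
  by (simp_all add: herm_form_def ring_distribs sum.distrib)

text \<open>A vector in the kernel has norm 0, hence vanishes. The transpose appears because
  \<open>herm_form\<close> contracts its first argument with the row index of
  \<open>G\<close>.\<close>

lemma posdef_invertible:
  assumes "hermitian_posdef G"
  shows "invertible G"
proof -
  have "v = 0" if "transpose G *v v = 0" for v
  proof (rule ccontr)
    assume "v \<noteq> 0"
    have "(\<Sum>i\<in>UNIV. G $ i $ j * v $ i) = 0" for j
      using that by (simp add: vec_eq_iff matrix_vector_mult_def transpose_def)
    moreover have "herm_form G v v = (\<Sum>j\<in>UNIV. (\<Sum>i\<in>UNIV. G $ i $ j * v $ i) * cnj (v $ j))"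
      unfolding herm_form_def by (subst sum.swap) (simp add: sum_distrib_right)
    ultimately have "herm_norm2 G v = 0" by (simp add: herm_norm2_def)
    then show False using assms \<open>v \<noteq> 0\<close> unfolding hermitian_posdef_def by fastforce
  qed
  then have "\<exists>B. B ** transpose G = mat 1"
    unfolding matrix_left_invertible_ker by blast
  then show ?thesis
    unfolding left_invertible_transpose invertible_def using matrix_left_right_inverse by blast
qed

lemma sum_product_interchange:
  fixes A :: "'i::finite \<Rightarrow> 'k::finite \<Rightarrow> complex" and B :: "'j::finite \<Rightarrow> 'l::finite \<Rightarrow> complex"
  shows "(\<Sum>i\<in>UNIV. \<Sum>k\<in>UNIV. A i k) * (\<Sum>j\<in>UNIV. \<Sum>l\<in>UNIV. B j l) =
    (\<Sum>i\<in>UNIV. \<Sum>j\<in>UNIV. \<Sum>k\<in>UNIV. \<Sum>l\<in>UNIV. A i k * B j l)"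
  unfolding sum_product ..

lemma sum_interchange4:
  "(\<Sum>p\<in>P. \<Sum>i\<in>I. \<Sum>j\<in>J. \<Sum>k\<in>K. \<Sum>l\<in>L. F p i j k l) =
    (\<Sum>i\<in>I. \<Sum>j\<in>J. \<Sum>k\<in>K. \<Sum>l\<in>L. \<Sum>p\<in>P. (F p i j k l :: complex))"
proof -
  have "(\<Sum>p\<in>P. \<Sum>i\<in>I. \<Sum>j\<in>J. \<Sum>k\<in>K. \<Sum>l\<in>L. F p i j k l) =
      (\<Sum>i\<in>I. \<Sum>p\<in>P. \<Sum>j\<in>J. \<Sum>k\<in>K. \<Sum>l\<in>L. F p i j k l)" by (rule sum.swap)
  also have "\<dots> = (\<Sum>i\<in>I. \<Sum>j\<in>J. \<Sum>p\<in>P. \<Sum>k\<in>K. \<Sum>l\<in>L. F p i j k l)"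
    by (intro sum.cong refl, rule sum.swap)
  also have "\<dots> = (\<Sum>i\<in>I. \<Sum>j\<in>J. \<Sum>k\<in>K. \<Sum>p\<in>P. \<Sum>l\<in>L. F p i j k l)"
    by (intro sum.cong refl, rule sum.swap)
  also have "\<dots> = (\<Sum>i\<in>I. \<Sum>j\<in>J. \<Sum>k\<in>K. \<Sum>l\<in>L. \<Sum>p\<in>P. F p i j k l)"
    by (intro sum.cong refl, rule sum.swap)
  finally show ?thesis .
qed

text \<open>The vector \<open>\<Gamma>(v, v)\<close> of the Chern connection, with the index order of \<open>chern_curvature\<close>.\<close>

definition christoffel ::
    "(complex ^ 'n::finite \<Rightarrow> complex ^ 'n ^ 'n) \<Rightarrow> complex ^ 'n \<Rightarrow> complex ^ 'n \<Rightarrow> complex ^ 'n"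
  where "christoffel G z v = (\<chi> p. \<Sum>q\<in>UNIV. matrix_inv (G z) $ q $ p *
    (\<Sum>i\<in>UNIV. \<Sum>k\<in>UNIV. wirtinger i (\<lambda>w. G w $ k $ q) z * v $ i * v $ k))"

text \<open>This is completing the square: the terms containing \<open>a\<close> are
  \<open>|a|\<^sup>2\<close> and twice the real part of its product with
  \<open>\<Gamma>(v, v)\<close>, and the missing \<open>|\<Gamma>(v, v)|\<^sup>2\<close> is exactly
  the part of the Chern curvature quadratic in first derivatives of the metric.\<close>

lemma dz_dzbar_metric_eq_curvature:
  fixes G :: "complex ^ 'n::finite \<Rightarrow> complex ^ 'n ^ 'n"
  assumes U: "open U" "smooth_map_on U G" "\<And>z. z \<in> U \<Longrightarrow> hermitian_posdef (G z)"
    and z: "z \<in> U" and v: "v \<noteq> 0"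
  shows "Re (dz_dzbar_metric G z v a)
    = herm_norm2 (G z) (a + christoffel G z v) - hol_sect_curv G z v * (herm_norm2 (G z) v)\<^sup>2"
proof -
  define b where "b = christoffel G z v"
  define W where "W q = (\<Sum>i\<in>UNIV. \<Sum>k\<in>UNIV. wirtinger i (\<lambda>w. G w $ k $ q) z * v $ i * v $ k)" for q
  define T where "T = (\<Sum>i\<in>UNIV. \<Sum>j\<in>UNIV. \<Sum>k\<in>UNIV. \<Sum>l\<in>UNIV.
    wirtinger i (wirtinger_bar j (\<lambda>w. G w $ k $ l)) z * v $ i * cnj (v $ j) * v $ k * cnj (v $ l))"
  note pd = U(3)[OF z]
  have inv: "matrix_inv (G z) ** G z = mat 1"
    using someI_ex[OF posdef_invertible[OF pd, unfolded invertible_def]] unfolding matrix_inv_def by blast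
  have b: "b $ p = (\<Sum>q\<in>UNIV. matrix_inv (G z) $ q $ p * W q)" for p
    by (simp add: b_def christoffel_def W_def)
  \<comment> \<open>\<open>W\<close> is \<open>\<Gamma>(v, v)\<close> with its index lowered:
    contracting with the metric undoes the inverse metric in \<open>christoffel\<close>.\<close>
  have W: "(\<Sum>p\<in>UNIV. G z $ p $ l * b $ p) = W l" for l
  proof -
    have "(\<Sum>p\<in>UNIV. G z $ p $ l * b $ p) =
        (\<Sum>q\<in>UNIV. \<Sum>p\<in>UNIV. matrix_inv (G z) $ q $ p * G z $ p $ l * W q)"
      unfolding b sum_distrib_left by (subst sum.swap) (simp add: mult_ac)
    also have "\<dots> = (\<Sum>q\<in>UNIV. (matrix_inv (G z) ** G z) $ q $ l * W q)"
      by (simp add: matrix_matrix_mult_def sum_distrib_right)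
    also have "\<dots> = W l" by (simp add: inv mat_def if_distrib[of "\<lambda>x. x * _"] cong: if_cong)
    finally show ?thesis .
  qed
  have Wb: "(\<Sum>l\<in>UNIV. W l * cnj (x $ l)) = herm_form (G z) b x" for x
    unfolding W[symmetric] herm_form_def by (subst sum.swap) (simp add: sum_distrib_right)
  have cW: "cnj (W p) = (\<Sum>j\<in>UNIV. \<Sum>l\<in>UNIV. wirtinger_bar j (\<lambda>w. G w $ p $ l) z * cnj (v $ j) * cnj (v $ l))" for p
    by (simp add: W_def cnj_wirtinger[OF U(1,2) z U(3)])
  have 1: "(\<Sum>k\<in>UNIV. \<Sum>l\<in>UNIV. (\<Sum>j\<in>UNIV. \<Sum>i\<in>UNIV.
      wirtinger i (wirtinger_bar j (\<lambda>w. G w $ k $ l)) z * v $ i * cnj (v $ j)) * v $ k * cnj (v $ l)) = T"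
  proof -
    have "T = (\<Sum>i\<in>UNIV. \<Sum>k\<in>UNIV. \<Sum>l\<in>UNIV. \<Sum>j\<in>UNIV.
        wirtinger i (wirtinger_bar j (\<lambda>w. G w $ k $ l)) z * v $ i * cnj (v $ j) * v $ k * cnj (v $ l))"
      unfolding T_def
      by (rule sum.cong[OF refl], subst sum.swap, rule sum.cong[OF refl], rule sum.swap)
    also have "\<dots> = (\<Sum>k\<in>UNIV. \<Sum>l\<in>UNIV. \<Sum>j\<in>UNIV. \<Sum>i\<in>UNIV.
        wirtinger i (wirtinger_bar j (\<lambda>w. G w $ k $ l)) z * v $ i * cnj (v $ j) * v $ k * cnj (v $ l))"
      by (subst sum.swap, rule sum.cong[OF refl], subst sum.swap, rule sum.cong[OF refl], rule sum.swap)
    finally show ?thesis by (simp add: sum_distrib_right)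
  qed
  have 2: "(\<Sum>k\<in>UNIV. \<Sum>l\<in>UNIV. (\<Sum>j\<in>UNIV. wirtinger_bar j (\<lambda>w. G w $ k $ l) z * cnj (v $ j))
      * a $ k * cnj (v $ l)) = cnj (herm_form (G z) b a)"
  proof -
    have "(\<Sum>l\<in>UNIV. (\<Sum>j\<in>UNIV. wirtinger_bar j (\<lambda>w. G w $ k $ l) z * cnj (v $ j)) * a $ k * cnj (v $ l))
        = cnj (W k) * a $ k" for k
      unfolding cW sum_distrib_right by (subst sum.swap) (simp add: mult_ac)
    then show ?thesis by (simp flip: Wb)
  qed
  have 3: "(\<Sum>k\<in>UNIV. \<Sum>l\<in>UNIV. (\<Sum>i\<in>UNIV. wirtinger i (\<lambda>w. G w $ k $ l) z * v $ i)
      * v $ k * cnj (a $ l)) = herm_form (G z) b a"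
  proof -
    have "(\<Sum>k\<in>UNIV. (\<Sum>i\<in>UNIV. wirtinger i (\<lambda>w. G w $ k $ l) z * v $ i) * v $ k * cnj (a $ l))
        = W l * cnj (a $ l)" for l
      unfolding W_def sum_distrib_right by (subst sum.swap) (simp add: mult_ac)
    then show ?thesis unfolding Wb[symmetric] by (subst sum.swap) simp
  qed
  \<comment> \<open>The curvature splits into second derivatives of the metric, giving
    \<open>- T\<close>, and a product of first derivatives. Once \<open>p\<close> and
    \<open>q\<close> are the outer indices, that product separates into \<open>W q\<close> and
    \<open>cnj (W p)\<close>.\<close>
  have "(\<Sum>i\<in>UNIV. \<Sum>j\<in>UNIV. \<Sum>k\<in>UNIV. \<Sum>l\<in>UNIV.
          chern_curvature G z i j k l * v $ i * cnj (v $ j) * v $ k * cnj (v $ l)) =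
      - T + (\<Sum>i\<in>UNIV. \<Sum>j\<in>UNIV. \<Sum>k\<in>UNIV. \<Sum>l\<in>UNIV. \<Sum>p\<in>UNIV. \<Sum>q\<in>UNIV. matrix_inv (G z) $ q $ p *
        ((wirtinger i (\<lambda>w. G w $ k $ q) z * v $ i * v $ k) *
        (wirtinger_bar j (\<lambda>w. G w $ p $ l) z * cnj (v $ j) * cnj (v $ l))))"
    (is "_ = - T + (\<Sum>i\<in>UNIV. \<Sum>j\<in>UNIV. \<Sum>k\<in>UNIV. \<Sum>l\<in>UNIV. \<Sum>p\<in>UNIV. \<Sum>q\<in>UNIV. ?E i j k l p q)")
    unfolding T_def chern_curvature_def sum_negf[symmetric] sum.distrib[symmetric]
    by (intro sum.cong refl, simp only: distrib_right sum_distrib_right mult_minus_left) (simp add: mult_ac)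
  also have "(\<Sum>i\<in>UNIV. \<Sum>j\<in>UNIV. \<Sum>k\<in>UNIV. \<Sum>l\<in>UNIV. \<Sum>p\<in>UNIV. \<Sum>q\<in>UNIV. ?E i j k l p q) =
      (\<Sum>p\<in>UNIV. \<Sum>q\<in>UNIV. matrix_inv (G z) $ q $ p * (W q * cnj (W p)))"
  proof -
    have "(\<Sum>p\<in>UNIV. \<Sum>q\<in>UNIV. matrix_inv (G z) $ q $ p * (W q * cnj (W p))) =
        (\<Sum>p\<in>UNIV. \<Sum>q\<in>UNIV. \<Sum>i\<in>UNIV. \<Sum>j\<in>UNIV. \<Sum>k\<in>UNIV. \<Sum>l\<in>UNIV. ?E i j k l p q)"
      unfolding cW unfolding W_def sum_product_interchange unfolding sum_distrib_left ..
    also have "\<dots> = (\<Sum>p\<in>UNIV. \<Sum>i\<in>UNIV. \<Sum>j\<in>UNIV. \<Sum>k\<in>UNIV. \<Sum>l\<in>UNIV. \<Sum>q\<in>UNIV. ?E i j k l p q)"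
      by (rule sum.cong[OF refl], rule sum_interchange4)
    also have "\<dots> = (\<Sum>i\<in>UNIV. \<Sum>j\<in>UNIV. \<Sum>k\<in>UNIV. \<Sum>l\<in>UNIV. \<Sum>p\<in>UNIV. \<Sum>q\<in>UNIV. ?E i j k l p q)"
      by (rule sum_interchange4)
    finally show ?thesis ..
  qed
  also have "\<dots> = (\<Sum>p\<in>UNIV. b $ p * cnj (W p))"
    by (simp only: b sum_distrib_right mult.assoc)
  also have "\<dots> = cnj (herm_form (G z) b b)"
    by (simp flip: Wb add: mult.commute)
  finally have "hol_sect_curv G z v = (herm_norm2 (G z) b - Re T) / (herm_norm2 (G z) v)\<^sup>2"
    by (simp add: hol_sect_curv_def herm_norm2_def)
  moreover have "herm_norm2 (G z) v > 0" using pd v hermitian_posdef_def by blast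
  ultimately have 4: "Re T = herm_norm2 (G z) b - hol_sect_curv G z v * (herm_norm2 (G z) v)\<^sup>2"
    by (simp add: field_simps)
  have "herm_form (G z) a b = cnj (herm_form (G z) b a)" by (rule herm_form_cnj[OF pd])
  then have 5: "herm_norm2 (G z) (a + b) = herm_norm2 (G z) a + 2 * Re (herm_form (G z) b a) + herm_norm2 (G z) b"
    by (simp add: herm_norm2_def herm_form_add)
  show ?thesis
    unfolding dz_dzbar_metric_def sum.distrib 1 2 3
    using 4 5 by (simp add: herm_norm2_def[of "G z" a] herm_form_def[of "G z" a a] flip: b_def)
qed

lemma dz_dzbar_norm_along_curve:
  fixes G :: "complex ^ 'n::finite \<Rightarrow> complex ^ 'n ^ 'n"
  assumes U: "open U" "smooth_map_on U G" "\<And>z. z \<in> U \<Longrightarrow> hermitian_posdef (G z)"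
    and r: "0 < r" and \<delta>U: "\<And>t. t \<in> ball 0 r \<Longrightarrow> \<delta> t \<in> U"
    and \<delta>: "\<And>t k. t \<in> ball 0 r \<Longrightarrow> ((\<lambda>s. \<delta> s $ k) has_field_derivative e t $ k) (at t)"
    and e: "\<And>t k. t \<in> ball 0 r \<Longrightarrow> ((\<lambda>s. e s $ k) has_field_derivative a t $ k) (at t)"
    and a: "\<And>k. ((\<lambda>s. a s $ k) has_field_derivative b $ k) (at 0)"
    and "e 0 \<noteq> 0"
  shows "has_dz_dzbar r (\<lambda>t. herm_norm2 (G (\<delta> t)) (e t))
    (herm_norm2 (G (\<delta> 0)) (a 0 + christoffel G (\<delta> 0) (e 0))
      - hol_sect_curv G (\<delta> 0) (e 0) * (herm_norm2 (G (\<delta> 0)) (e 0))\<^sup>2)"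
proof -
  have "\<delta> 0 \<in> U" using \<delta>U r by simp
  from dz_dzbar_metric_eq_curvature[OF U this \<open>e 0 \<noteq> 0\<close>] herm_norm2_along_curve[OF assms(1-8)]
  show ?thesis unfolding has_dz_dzbar_def by metis
qed

section \<open>Schwarz inequality at a maximum\<close>

lemma holomorphic_map_onD:
  assumes "holomorphic_map_on V F" and "z \<in> V"
  shows "(F has_derivative frechet_derivative F (at z)) (at z)"
    and "frechet_derivative F (at z) (c *s v) = c *s frechet_derivative F (at z) v"
proof -
  obtain f' where f': "(F has_derivative f') (at z)" "\<And>c v. f' (c *s v) = c *s f' v"
    using assms unfolding holomorphic_map_on_def by blast
  from frechet_derivative_at[OF f'(1)] f'
  show "(F has_derivative frechet_derivative F (at z)) (at z)"
    "frechet_derivative F (at z) (c *s v) = c *s frechet_derivative F (at z) v" by auto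
qed

text \<open>Complex linearity of the derivative of \<open>F\<close> turns the real chain rule into
  complex differentiability in one variable, which opens the way to Cauchy's theory.\<close>

lemma holomorphic_map_on_along_curve:
  assumes "holomorphic_map_on V F" and "\<gamma> t \<in> V"
    and "\<And>k. ((\<lambda>s. \<gamma> s $ k) has_field_derivative e $ k) (at t)"
  shows "((\<lambda>s. F (\<gamma> s) $ k) has_field_derivative frechet_derivative F (at (\<gamma> t)) e $ k) (at t)"
proof -
  have "((\<lambda>s. F (\<gamma> s)) has_derivative (\<lambda>h. frechet_derivative F (at (\<gamma> t)) (h *s e))) (at t)"
    by (rule has_derivative_compose[OF has_derivative_vec_of_field[OF assms(3)]
          holomorphic_map_onD(1)[OF assms(1,2)]])
  from bounded_linear.has_derivative[OF bounded_linear_vec_nth this, of k]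
  show ?thesis
    by (simp add: holomorphic_map_onD(2)[OF assms(1,2)] has_field_derivative_def mult_commute_abs)
qed

text \<open>Cauchy's inequality in the direction \<open>j\<close>: on parallel discs centred at
  \<open>z\<close> and \<open>z0\<close> the values of \<open>F\<close> are uniformly close, hence
  so are the derivatives at the two centres.\<close>

lemma continuous_on_partial_derivative:
  fixes F :: "complex ^ 'm::finite \<Rightarrow> complex ^ 'n::finite"
  assumes V: "open V" and F: "holomorphic_map_on V F"
  shows "continuous_on V (\<lambda>z. frechet_derivative F (at z) (axis j 1) $ k)"
proof (rule continuous_on_iff[THEN iffD2], intro ballI allI impI)
  fix z0 and \<epsilon> :: real assume z0: "z0 \<in> V" and \<epsilon>: "0 < \<epsilon>"
  obtain R where R: "0 < R" "cball z0 R \<subseteq> V"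
    using V z0 open_contains_cball by blast
  \<comment> \<open>Half of \<open>R\<close>: a disc of radius \<open>r\<close> around any point
    within \<open>r\<close> of \<open>z0\<close> stays in the closed ball of radius
    \<open>R\<close>.\<close>
  define r where "r = R / 2"
  have r: "0 < r" using R by (simp add: r_def)
  have nF: "continuous_on (cball z0 R) F"
    using R(2) holomorphic_map_onD(1)[OF F]
    by (meson continuous_at_imp_continuous_on has_derivative_continuous subsetD)
  have "uniformly_continuous_on (cball z0 R) F"
    by (rule compact_uniformly_continuous[OF nF compact_cball])
  \<comment> \<open>Cauchy's inequality divides this bound by \<open>r\<close>; the remaining
    \<open>\<epsilon> / 2\<close> gives the strict estimate.\<close>
  moreover have "0 < \<epsilon> * r / 2" using \<epsilon> r by simp
  ultimately obtain \<delta> where \<delta>: "0 < \<delta>"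
    "\<And>x y. x \<in> cball z0 R \<Longrightarrow> y \<in> cball z0 R \<Longrightarrow> dist y x < \<delta> \<Longrightarrow> dist (F y) (F x) < \<epsilon> * r / 2"
    unfolding uniformly_continuous_on_def by meson
  have der: "((\<lambda>s. F (z + axis j s) $ k) has_field_derivative
      frechet_derivative F (at (z + axis j t)) (axis j 1) $ k) (at t)"
    if "z + axis j t \<in> V" for z t
  proof (rule holomorphic_map_on_along_curve[where \<gamma> = "\<lambda>s. z + axis j s", OF F that])
    fix k :: 'm
    show "((\<lambda>s. (z + axis j s) $ k) has_field_derivative axis j (1::complex) $ k) (at t)"
      by (cases "k = j") (auto simp: axis_def intro!: derivative_eq_intros)
  qed
  show "\<exists>d>0. \<forall>x\<in>V. dist x z0 < d \<longrightarrow>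
      dist (frechet_derivative F (at x) (axis j 1) $ k) (frechet_derivative F (at z0) (axis j 1) $ k) < \<epsilon>"
  proof (intro exI[of _ "min \<delta> r"] conjI ballI impI)
    show "0 < min \<delta> r" using \<delta>(1) r by simp
    fix z assume "z \<in> V" and d: "dist z z0 < min \<delta> r"
    have mem: "z + axis j t \<in> cball z0 R" "z0 + axis j t \<in> cball z0 R" if "t \<in> cball 0 r" for t
    proof -
      have t: "norm (axis j t) \<le> r" using that by (simp add: norm_eq_sqrt_inner inner_axis_axis)
      have "norm (z - z0 + axis j t) \<le> norm (z - z0) + norm (axis j t)" by (rule norm_triangle_ineq)
      then have "dist (z + axis j t) z0 \<le> R" using t d by (simp add: dist_norm r_def algebra_simps)
      then show "z + axis j t \<in> cball z0 R" by (simp add: dist_commute)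
      show "z0 + axis j t \<in> cball z0 R" using t R(1) by (simp add: dist_norm r_def)
    qed
    let ?g = "\<lambda>s. F (z + axis j s) $ k - F (z0 + axis j s) $ k"
    have g: "(?g has_field_derivative
        frechet_derivative F (at (z + axis j t)) (axis j 1) $ k
        - frechet_derivative F (at (z0 + axis j t)) (axis j 1) $ k) (at t)" if "t \<in> cball 0 r" for t
      by (intro DERIV_diff der subsetD[OF R(2)] mem that)
    have "norm ((deriv ^^ 1) ?g 0) \<le> fact 1 * (\<epsilon> * r / 2) / r ^ 1"
    proof (rule Cauchy_inequality[OF _ _ r])
      show "?g holomorphic_on ball 0 r"
        by (subst holomorphic_on_open) (use g ball_subset_cball in blast)+
      show "continuous_on (cball 0 r) ?g"
        by (intro continuous_at_imp_continuous_on ballI DERIV_isCont[OF g])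
      fix t :: complex assume "norm (0 - t) = r"
      then have "t \<in> cball 0 r" by simp
      then have "dist (F (z + axis j t)) (F (z0 + axis j t)) < \<epsilon> * r / 2"
        using d by (intro \<delta>(2) mem) (simp_all add: dist_norm)
      then show "norm (?g t) \<le> \<epsilon> * r / 2"
        using Finite_Cartesian_Product.norm_nth_le[of "F (z + axis j t) - F (z0 + axis j t)" k]
        by (simp add: dist_norm)
    qed
    moreover have "deriv ?g 0 = frechet_derivative F (at z) (axis j 1) $ k
        - frechet_derivative F (at z0) (axis j 1) $ k"
      using DERIV_imp_deriv[OF g[of 0]] r by (simp add: axis_def zero_vec_def[symmetric])
    ultimately have "norm (frechet_derivative F (at z) (axis j 1) $ k
        - frechet_derivative F (at z0) (axis j 1) $ k) \<le> \<epsilon> / 2"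
      using r by simp
    then show "dist (frechet_derivative F (at z) (axis j 1) $ k)
        (frechet_derivative F (at z0) (axis j 1) $ k) < \<epsilon>"
      using \<epsilon> by (simp add: dist_norm)
  qed
qed

lemma continuous_on_holomorphic_derivative:
  fixes F :: "complex ^ 'm::finite \<Rightarrow> complex ^ 'n::finite"
  assumes V: "open V" and F: "holomorphic_map_on V F"
  shows "continuous_on (V \<times> UNIV) (\<lambda>x. frechet_derivative F (at (fst x)) (snd x))"
proof -
  have eq: "frechet_derivative F (at z) v = (\<chi> k. \<Sum>j\<in>UNIV. v $ j * frechet_derivative F (at z) (axis j 1) $ k)"
    if "z \<in> V" for z v
  proof -
    have lin: "linear (frechet_derivative F (at z))"
      using holomorphic_map_onD(1)[OF F that] has_derivative_linear by blast
    have "frechet_derivative F (at z) v = frechet_derivative F (at z) (\<Sum>j\<in>UNIV. v $ j *s axis j 1)"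
      by (simp add: basis_expansion)
    also have "\<dots> = (\<Sum>j\<in>UNIV. v $ j *s frechet_derivative F (at z) (axis j 1))"
      by (simp add: linear_sum[OF lin] holomorphic_map_onD(2)[OF F that])
    finally show ?thesis by (simp add: vec_eq_iff)
  qed
  have c: "continuous_on (V \<times> UNIV) (\<lambda>x. frechet_derivative F (at (fst x)) (axis j 1) $ k)" for j k
    by (rule continuous_on_compose2[OF continuous_on_partial_derivative[OF V F]])
      (auto intro: continuous_intros)
  have "continuous_on (V \<times> UNIV) (\<lambda>x. \<chi> k. \<Sum>j\<in>UNIV. snd x $ j * frechet_derivative F (at (fst x)) (axis j 1) $ k)"
    by (intro continuous_intros c)
  then show ?thesis
    by (rule continuous_on_eq, intro eq[symmetric]) auto
qed

text \<open>The hypothesis \<open>max\<close> is cross-multiplied so that, evaluated along the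
  curve, it says directly that a difference of two squared norms is nonnegative.\<close>

lemma schwarz_at_maximum:
  fixes F :: "complex ^ 'm::finite \<Rightarrow> complex ^ 'n::finite"
  assumes V: "open V" "smooth_map_on V G" "\<And>z. z \<in> V \<Longrightarrow> hermitian_posdef (G z)"
    and U: "open U" "smooth_map_on U K" "\<And>z. z \<in> U \<Longrightarrow> hermitian_posdef (K z)"
    and F: "holomorphic_map_on V F" "F ` V \<subseteq> U"
    and z0: "z0 \<in> V" and v: "v \<noteq> 0" and w: "frechet_derivative F (at z0) v \<noteq> 0"
    and max: "\<And>z u. z \<in> V \<Longrightarrow>
      herm_norm2 (K (F z)) (frechet_derivative F (at z) u) * herm_norm2 (G z0) v
      \<le> herm_norm2 (K (F z0)) (frechet_derivative F (at z0) v) * herm_norm2 (G z) u"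
  shows "hol_sect_curv G z0 v * herm_norm2 (G z0) v \<le>
    hol_sect_curv K (F z0) (frechet_derivative F (at z0) v)
      * herm_norm2 (K (F z0)) (frechet_derivative F (at z0) v)"
proof -
  define a where "a = - christoffel G z0 v"
  \<comment> \<open>A quadratic polynomial suffices: the second derivative is the constant
    \<open>a\<close>, and the third is 0. The curve is needed only near 0, where it stays in
    \<open>V\<close>.\<close>
  define \<gamma> where "\<gamma> t = z0 + t *s v + (t\<^sup>2 / 2) *s a" for t
  define e where "e t = v + t *s a" for t
  let ?w = "frechet_derivative F (at z0) v"
  define P where "P t = herm_norm2 (G (\<gamma> t)) (e t)" for t
  have 0: "\<gamma> 0 = z0" "e 0 = v" by (simp_all add: \<gamma>_def e_def)
  have \<gamma>: "((\<lambda>s. \<gamma> s $ k) has_field_derivative e t $ k) (at t)" for t k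
    unfolding \<gamma>_def e_def by (auto intro!: derivative_eq_intros)
  have e: "((\<lambda>s. e s $ k) has_field_derivative a $ k) (at t)" for t k
    unfolding e_def by (auto intro!: derivative_eq_intros)
  have "isCont \<gamma> t" for t
    using has_derivative_continuous[OF has_derivative_vec_of_field[OF \<gamma>]] .
  then have "open (\<gamma> -` V)" using V(1) continuous_at_imp_continuous_on open_vimage by blast
  moreover have "0 \<in> \<gamma> -` V" using z0 0 by simp
  ultimately obtain r where r: "0 < r" "ball 0 r \<subseteq> \<gamma> -` V"
    using open_contains_ball by blast
  have \<gamma>V: "\<gamma> t \<in> V" if "t \<in> ball 0 r" for t using r that by blast
  define f where "f t = frechet_derivative F (at (\<gamma> t)) (e t)" for t
  define Q where "Q t = herm_norm2 (K (F (\<gamma> t))) (f t)" for t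
  have \<delta>: "((\<lambda>s. F (\<gamma> s) $ k) has_field_derivative f t $ k) (at t)" if "t \<in> ball 0 r" for t k
    unfolding f_def by (rule holomorphic_map_on_along_curve[OF F(1) \<gamma>V[OF that] \<gamma>])
  \<comment> \<open>The velocity of the image curve is the derivative of a holomorphic function of
    one variable, so it is holomorphic, and so are the derivatives \<open>a'\<close> and
    \<open>b'\<close> arise from.\<close>
  have fh: "(\<lambda>s. f s $ k) holomorphic_on ball 0 r" for k
  proof (rule holomorphic_transform[OF holomorphic_deriv])
    show "(\<lambda>s. F (\<gamma> s) $ k) holomorphic_on ball 0 r"
      using \<delta> by (subst holomorphic_on_open) blast+
    show "deriv (\<lambda>s. F (\<gamma> s) $ k) t = f t $ k" if "t \<in> ball 0 r" for t
      by (rule DERIV_imp_deriv[OF \<delta>[OF that]])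
  qed simp
  define a' where "a' t = (\<chi> k. deriv (\<lambda>s. f s $ k) t)" for t
  have f': "((\<lambda>s. f s $ k) has_field_derivative a' t $ k) (at t)" if "t \<in> ball 0 r" for t k
    using holomorphic_derivI[OF fh _ that] by (simp add: a'_def)
  have a'h: "(\<lambda>s. a' s $ k) holomorphic_on ball 0 r" for k
    unfolding a'_def using holomorphic_deriv[OF fh] by simp
  define b' where "b' = (\<chi> k. deriv (\<lambda>s. a' s $ k) 0)"
  have a'': "((\<lambda>s. a' s $ k) has_field_derivative b' $ k) (at 0)" for k
    using holomorphic_derivI[OF a'h, of 0] r(1) by (simp add: b'_def)
  have f0: "f 0 = ?w" by (simp add: f_def 0)
  have FU: "F z \<in> U" if "z \<in> V" for z using F(2) that by blast
  have a': "((\<lambda>s. a $ k) has_field_derivative 0 $ k) (at 0)" for k by simp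
  have "e 0 \<noteq> 0" "f 0 \<noteq> 0" using v w 0 f0 by simp_all
  have "has_dz_dzbar r P (herm_norm2 (G (\<gamma> 0)) (a + christoffel G (\<gamma> 0) (e 0))
      - hol_sect_curv G (\<gamma> 0) (e 0) * (herm_norm2 (G (\<gamma> 0)) (e 0))\<^sup>2)"
    unfolding P_def[abs_def]
    by (rule dz_dzbar_norm_along_curve[where a = "\<lambda>_. a" and b = 0,
          OF V r(1) \<gamma>V \<gamma> e a' \<open>e 0 \<noteq> 0\<close>])
  then have Pm: "has_dz_dzbar r P (- hol_sect_curv G z0 v * (herm_norm2 (G z0) v)\<^sup>2)"
    by (simp add: 0 a_def herm_norm2_zero)
  have Qm: "has_dz_dzbar r Q (herm_norm2 (K (F (\<gamma> 0))) (a' 0 + christoffel K (F (\<gamma> 0)) (f 0))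
      - hol_sect_curv K (F (\<gamma> 0)) (f 0) * (herm_norm2 (K (F (\<gamma> 0))) (f 0))\<^sup>2)"
    (is "has_dz_dzbar r Q ?m")
    unfolding Q_def[abs_def]
    by (rule dz_dzbar_norm_along_curve[OF U r(1) FU[OF \<gamma>V] \<delta> f' a'' \<open>f 0 \<noteq> 0\<close>])
  define p q where "p = herm_norm2 (G z0) v" and "q = herm_norm2 (K (F z0)) ?w"
  have pq: "0 < p" "0 < q"
    using V(3)[OF z0] U(3)[OF FU[OF z0]] v w unfolding p_def q_def hermitian_posdef_def by blast+
  have PQ0: "P 0 = p" "Q 0 = q" by (simp_all add: P_def Q_def 0 f0 p_def q_def)
  have "0 \<le> q * (- hol_sect_curv G z0 v * (herm_norm2 (G z0) v)\<^sup>2) - p * ?m"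
  proof (rule has_dz_dzbar_nonneg_at_min[OF r(1) has_dz_dzbar_linear[OF Pm Qm]])
    fix t :: complex assume t: "t \<in> ball 0 r"
    have "q * P 0 - p * Q 0 = 0" by (simp add: PQ0)
    also have "0 \<le> q * P t - p * Q t"
      using max[OF \<gamma>V[OF t], of "e t"] by (simp add: P_def Q_def f_def p_def q_def mult.commute)
    finally show "q * P 0 - p * Q 0 \<le> q * P t - p * Q t" .
  qed
  \<comment> \<open>The uncontrolled acceleration \<open>a' 0\<close> enters \<open>?m\<close> only
    through a squared norm, which may be discarded from below.\<close>
  moreover have "p * (- hol_sect_curv K (F z0) ?w * q\<^sup>2) \<le> p * ?m"
    using pq herm_norm2_nonneg[OF U(3)[OF FU[OF z0]], of "a' 0 + christoffel K (F z0) ?w"]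
    by (intro mult_left_mono) (simp_all add: 0 f0 q_def)
  ultimately have "p * (- hol_sect_curv K (F z0) ?w * q\<^sup>2) \<le> q * (- hol_sect_curv G z0 v * p\<^sup>2)"
    unfolding p_def by linarith
  then have "(p * q) * (hol_sect_curv G z0 v * p) \<le> (p * q) * (hol_sect_curv K (F z0) ?w * q)"
    by (simp add: power2_eq_square mult_ac)
  then show ?thesis using pq by (simp add: p_def q_def)
qed

section \<open>Holomorphic maps between Hermitian manifolds\<close>

lemma times_cont_diff_on_subset:
  "times_cont_diff_on k S f \<Longrightarrow> T \<subseteq> S \<Longrightarrow> times_cont_diff_on k T f"
  by (induction k arbitrary: f) (auto intro: continuous_on_subset)

lemma smooth_map_on_subset: "smooth_map_on S f \<Longrightarrow> T \<subseteq> S \<Longrightarrow> smooth_map_on T f"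
  unfolding smooth_map_on_def using times_cont_diff_on_subset by blast

lemma smooth_map_on_imp_continuous_on: "smooth_map_on S f \<Longrightarrow> continuous_on S f"
  unfolding smooth_map_on_def by (metis times_cont_diff_on.simps(1))

lemma continuous_on_herm_norm2:
  assumes "continuous_on S G" and "continuous_on S v"
  shows "continuous_on S (\<lambda>x. herm_norm2 (G x) (v x))"
  unfolding herm_norm2_def herm_form_def by (intro continuous_intros assms)

lemma herm_norm2_scaleR: "herm_norm2 G (c *\<^sub>R v) = c\<^sup>2 * herm_norm2 G v"
proof -
  have "herm_form G (c *\<^sub>R v) (c *\<^sub>R v) = of_real (c\<^sup>2) * herm_form G v v"
    unfolding herm_form_def sum_distrib_left
    by (intro sum.cong refl) (simp add: scaleR_conv_of_real[where 'a = complex] power2_eq_square mult_ac)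
  then show ?thesis by (simp add: herm_norm2_def)
qed

section \<open>Charts as homeomorphisms onto open sets\<close>

lemma chart_inv_chart:
  assumes "is_chart X c" and "x \<in> fst c"
  shows "chart_inv c (snd c x) = x"
proof -
  have "topspace (subtopology X (fst c)) = fst c"
    using assms(1) openin_subset unfolding is_chart_def by fastforce
  then have "inj_on (snd c) (fst c)"
    using assms(1) homeomorphic_imp_injective_map unfolding is_chart_def by fastforce
  then show ?thesis using assms(2) by (simp add: chart_inv_def)
qed

lemma open_chart_image:
  assumes c: "is_chart X c" and S: "openin X S" "S \<subseteq> fst c"
  shows "open (snd c ` S)"
proof -
  have "openin (subtopology X (fst c)) S"
    using c S by (simp add: is_chart_def openin_open_subtopology)
  then have "openin (top_of_set (snd c ` fst c)) (snd c ` S)"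
    using c homeomorphic_imp_open_map unfolding is_chart_def open_map_def by blast
  then show ?thesis using c openin_open_trans unfolding is_chart_def by blast
qed

lemma openin_chart_vimage:
  assumes c: "is_chart X c" and W: "open W"
  shows "openin X {x \<in> fst c. snd c x \<in> W}"
proof -
  have top: "topspace (subtopology X (fst c)) = fst c"
    using c openin_subset unfolding is_chart_def by fastforce
  have "continuous_map (subtopology X (fst c)) euclidean (snd c)"
    using c homeomorphic_imp_continuous_map continuous_map_in_subtopology
    unfolding is_chart_def by blast
  from openin_continuous_map_preimage[OF this, of W] W
  have "openin (subtopology X (fst c)) {x \<in> fst c. snd c x \<in> W}" by (simp only: top) simp
  then show ?thesis using c openin_trans_full unfolding is_chart_def by blast
qed

text \<open>Coordinate expressions are meaningful on chart images only, so two composites of them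
  can be expected to agree merely near \<open>x\<close>.\<close>

lemma has_derivative_compose_within_open:
  assumes "(f has_derivative f') (at x)" and "(g has_derivative g') (at (f x))"
    and "open S" "x \<in> S" "\<And>y. y \<in> S \<Longrightarrow> g (f y) = k y"
  shows "(k has_derivative (\<lambda>v. g' (f' v))) (at x)"
  by (rule has_derivative_transform_within_open[OF has_derivative_compose[OF assms(1,2)] assms(3,4)])
    (use assms(5) in auto)

section \<open>Coordinate representatives and change of charts\<close>

locale hermitian_holomorphic_map =
  fixes X :: "'a topology" and A :: "('a, 'm::finite) chart set"
    and g :: "('a, 'm) chart \<Rightarrow> complex ^ 'm \<Rightarrow> complex ^ 'm ^ 'm"
    and Y :: "'b topology" and B :: "('b, 'n::finite) chart set"
    and h :: "('b, 'n) chart \<Rightarrow> complex ^ 'n \<Rightarrow> complex ^ 'n ^ 'n"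
    and f :: "'a \<Rightarrow> 'b"
  assumes X: "hermitian_manifold X A g" and Y: "hermitian_manifold Y B h"
    and f: "holomorphic_map X A Y B f"
begin

definition rep_dom :: "('a, 'm) chart \<Rightarrow> ('b, 'n) chart \<Rightarrow> (complex ^ 'm) set"
  where "rep_dom c d = snd c ` (fst c \<inter> f -` fst d)"

definition rep :: "('a, 'm) chart \<Rightarrow> ('b, 'n) chart \<Rightarrow> complex ^ 'm \<Rightarrow> complex ^ 'n"
  where "rep c d = snd d \<circ> f \<circ> chart_inv c"

definition norm2_pullback :: "('a, 'm) chart \<Rightarrow> ('b, 'n) chart \<Rightarrow> complex ^ 'm \<Rightarrow> complex ^ 'm \<Rightarrow> real"
  where "norm2_pullback c d z v = herm_norm2 (h d (rep c d z)) (frechet_derivative (rep c d) (at z) v)"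

lemma chartX: "c \<in> A \<Longrightarrow> is_chart X c"
  using X unfolding hermitian_manifold_def complex_manifold_def by blast

lemma chartY: "d \<in> B \<Longrightarrow> is_chart Y d"
  using Y unfolding hermitian_manifold_def complex_manifold_def by blast

lemma metricX:
  assumes "c \<in> A"
  shows "smooth_map_on (snd c ` fst c) (g c)"
    and "z \<in> snd c ` fst c \<Longrightarrow> hermitian_posdef (g c z)"
  using X assms unfolding hermitian_manifold_def hermitian_metric_def by blast+

lemma metricY:
  assumes "d \<in> B"
  shows "smooth_map_on (snd d ` fst d) (h d)"
    and "z \<in> snd d ` fst d \<Longrightarrow> hermitian_posdef (h d z)"
  using Y assms unfolding hermitian_manifold_def hermitian_metric_def by blast+

lemma holomorphic_rep: "c \<in> A \<Longrightarrow> d \<in> B \<Longrightarrow> holomorphic_map_on (rep_dom c d) (rep c d)"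
  using f unfolding holomorphic_map_def rep_dom_def rep_def by blast

lemma openin_preimage:
  assumes "openin X S" and "openin Y T"
  shows "openin X (S \<inter> f -` T)"
proof -
  have "openin X {x \<in> S. f x \<in> T}"
    using openin_continuous_map_preimage_gen f assms unfolding holomorphic_map_def by blast
  moreover have "{x \<in> S. f x \<in> T} = S \<inter> f -` T" by blast
  ultimately show ?thesis by simp
qed

lemma open_rep_dom: "c \<in> A \<Longrightarrow> d \<in> B \<Longrightarrow> open (rep_dom c d)"
  unfolding rep_dom_def
  by (rule open_chart_image[OF chartX openin_preimage]) (use chartX chartY is_chart_def in blast)+

lemma rep_dom_subset: "rep_dom c d \<subseteq> snd c ` fst c"
  unfolding rep_dom_def by blast

lemma rep_chart: "c \<in> A \<Longrightarrow> x \<in> fst c \<Longrightarrow> rep c d (snd c x) = snd d (f x)"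
  by (simp add: rep_def chart_inv_chart[OF chartX])

lemma rep_image: "c \<in> A \<Longrightarrow> rep c d ` rep_dom c d \<subseteq> snd d ` fst d"
  unfolding rep_dom_def using rep_chart by fastforce

lemma obtain_charts:
  assumes "x \<in> topspace X"
  obtains c d where "c \<in> A" "d \<in> B" "x \<in> fst c" "f x \<in> fst d"
proof -
  have "f x \<in> topspace Y"
    using f assms continuous_map_image_subset_topspace unfolding holomorphic_map_def by blast
  then show thesis
    using that assms X Y unfolding hermitian_manifold_def complex_manifold_def by blast
qed

text \<open>The ratio to be maximized does not depend on the charts. The witness is the image of
  \<open>v\<close> under the derivative of the transition map; differentiating
  \<open>rep c' d' \<circ> transition c c'\<close> and
  \<open>transition d d' \<circ> rep c d\<close>, which agree near the point, relates the two
  differentials.\<close>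

lemma change_of_charts:
  assumes c: "c \<in> A" "c' \<in> A" and d: "d \<in> B" "d' \<in> B"
    and x: "x \<in> fst c" "x \<in> fst c'" "f x \<in> fst d" "f x \<in> fst d'"
  obtains v' where "herm_norm2 (g c' (snd c' x)) v' = herm_norm2 (g c (snd c x)) v"
    and "norm2_pullback c' d' (snd c' x) v' = norm2_pullback c d (snd c x) v"
proof
  let ?\<tau> = "transition c c'" and ?\<sigma> = "transition d d'" and ?z = "snd c x"
  let ?v' = "frechet_derivative ?\<tau> (at ?z) v"
  \<comment> \<open>The part of the source where all four charts apply, seen in \<open>c\<close>;
    both composites are defined and equal there.\<close>
  define S where "S = snd c ` ((fst c \<inter> fst c') \<inter> f -` (fst d \<inter> fst d'))"
  have S: "open S" unfolding S_def
    by (rule open_chart_image[OF chartX[OF c(1)] openin_preimage])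
      (use chartX[OF c(1)] chartX[OF c(2)] chartY[OF d(1)] chartY[OF d(2)] in \<open>auto simp: is_chart_def\<close>)
  have z: "?z \<in> S" using x by (auto simp: S_def)
  have \<tau>z: "?\<tau> ?z = snd c' x" using chart_inv_chart[OF chartX[OF c(1)] x(1)] by (simp add: transition_def)
  have repz: "rep c d ?z = snd d (f x)" by (rule rep_chart[OF c(1) x(1)])
  have \<sigma>: "?\<sigma> (snd d (f x)) = snd d' (f x)"
    using chart_inv_chart[OF chartY[OF d(1)] x(3)] by (simp add: transition_def)
  have z1: "?z \<in> snd c ` (fst c \<inter> fst c')" and z2: "snd d (f x) \<in> snd d ` (fst d \<inter> fst d')" using x by auto
  have h\<tau>: "holomorphic_map_on (snd c ` (fst c \<inter> fst c')) ?\<tau>"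
    using X c unfolding hermitian_manifold_def complex_manifold_def by blast
  have h\<sigma>: "holomorphic_map_on (snd d ` (fst d \<inter> fst d')) ?\<sigma>"
    using Y d unfolding hermitian_manifold_def complex_manifold_def by blast
  have D\<tau>: "(?\<tau> has_derivative frechet_derivative ?\<tau> (at ?z)) (at ?z)"
    by (rule holomorphic_map_onD(1)[OF h\<tau> z1])
  have D\<sigma>: "(?\<sigma> has_derivative frechet_derivative ?\<sigma> (at (snd d (f x)))) (at (rep c d ?z))"
    unfolding repz by (rule holomorphic_map_onD(1)[OF h\<sigma> z2])
  have "?z \<in> rep_dom c d" "snd c' x \<in> rep_dom c' d'" using x unfolding rep_dom_def by auto
  then have Dr: "(rep c d has_derivative frechet_derivative (rep c d) (at ?z)) (at ?z)"
    and Dr': "(rep c' d' has_derivative frechet_derivative (rep c' d') (at (snd c' x))) (at (?\<tau> ?z))"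
    unfolding \<tau>z using holomorphic_map_onD(1) holomorphic_rep c d by blast+
  have "(rep c' d' \<circ> ?\<tau> has_derivative
      (\<lambda>v. frechet_derivative (rep c' d') (at (snd c' x)) (frechet_derivative ?\<tau> (at ?z) v))) (at ?z)"
    by (rule has_derivative_compose_within_open[OF D\<tau> Dr' S z]) simp
  moreover have "(rep c' d' \<circ> ?\<tau> has_derivative
      (\<lambda>v. frechet_derivative ?\<sigma> (at (snd d (f x))) (frechet_derivative (rep c d) (at ?z) v))) (at ?z)"
  proof (rule has_derivative_compose_within_open[OF Dr D\<sigma> S z])
    fix y assume "y \<in> S"
    then obtain w where w: "y = snd c w" "w \<in> fst c" "w \<in> fst c'" "f w \<in> fst d" "f w \<in> fst d'"
      unfolding S_def by auto
    have "?\<sigma> (rep c d y) = snd d' (f w)"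
      using w by (simp add: rep_chart[OF c(1)] transition_def chart_inv_chart[OF chartY[OF d(1)]])
    moreover have "rep c' d' (?\<tau> y) = snd d' (f w)"
      using w by (simp add: rep_chart[OF c(2)] transition_def chart_inv_chart[OF chartX[OF c(1)]])
    ultimately show "?\<sigma> (rep c d y) = (rep c' d' \<circ> ?\<tau>) y" by simp
  qed
  ultimately have eq: "frechet_derivative (rep c' d') (at (snd c' x)) ?v' =
      frechet_derivative ?\<sigma> (at (snd d (f x))) (frechet_derivative (rep c d) (at ?z) v)"
    using has_derivative_unique by metis
  have "herm_form (g c ?z) v v = herm_form (g c' (?\<tau> ?z)) ?v' ?v'"
    using X c z1 unfolding hermitian_manifold_def hermitian_metric_def by blast
  then show "herm_norm2 (g c' (snd c' x)) ?v' = herm_norm2 (g c ?z) v"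
    by (simp add: herm_norm2_def \<tau>z)
  have "herm_form (h d (snd d (f x))) w w = herm_form (h d' (?\<sigma> (snd d (f x))))
      (frechet_derivative ?\<sigma> (at (snd d (f x))) w) (frechet_derivative ?\<sigma> (at (snd d (f x))) w)" for w
    using Y d z2 unfolding hermitian_manifold_def hermitian_metric_def by blast
  then show "norm2_pullback c' d' (snd c' x) ?v' = norm2_pullback c d ?z v"
    by (simp add: norm2_pullback_def herm_norm2_def eq repz rep_chart[OF c(2) x(2)] \<sigma>)
qed

section \<open>Existence of a maximal ratio on a compact source\<close>

lemma norm2_pullback_scaleR:
  assumes "c \<in> A" and "d \<in> B" and "z \<in> rep_dom c d"
  shows "norm2_pullback c d z (a *\<^sub>R v) = a\<^sup>2 * norm2_pullback c d z v"
proof -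
  have "linear (frechet_derivative (rep c d) (at z))"
    using holomorphic_map_onD(1)[OF holomorphic_rep[OF assms(1,2)] assms(3)] has_derivative_linear by blast
  then show ?thesis by (simp add: norm2_pullback_def linear_scale herm_norm2_scaleR)
qed

text \<open>The maximum is taken over a closed coordinate ball, while \<open>T\<close> corresponds
  to the open one, so the maximizing point may lie on the boundary, outside
  \<open>T\<close>.\<close>

lemma local_maximum:
  assumes c: "c \<in> A" and d: "d \<in> B" and x: "x \<in> fst c" "f x \<in> fst d"
  obtains T z v where "openin X T" "x \<in> T" "T \<subseteq> fst c \<inter> f -` fst d"
    and "z \<in> rep_dom c d" "v \<noteq> 0"
    and "\<forall>y\<in>T. \<forall>u. norm2_pullback c d (snd c y) u
      \<le> norm2_pullback c d z v / herm_norm2 (g c z) v * herm_norm2 (g c (snd c y)) u"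
proof -
  have "snd c x \<in> rep_dom c d" using x unfolding rep_dom_def by auto
  then obtain r where r: "0 < r" "cball (snd c x) r \<subseteq> rep_dom c d"
    using open_rep_dom[OF c d] open_contains_cball by blast
  \<comment> \<open>The ratio is unchanged when the vector is rescaled, so the Euclidean unit sphere
    can replace the metric unit vectors, and a compact product replaces the sphere bundle.\<close>
  let ?K = "cball (snd c x) r \<times> sphere (0::complex ^ 'm) 1"
  let ?P = "\<lambda>p. herm_norm2 (g c (fst p)) (snd p)"
  let ?Q = "\<lambda>p. norm2_pullback c d (fst p) (snd p)"
  have sub: "cball (snd c x) r \<subseteq> snd c ` fst c" using r(2) rep_dom_subset by blast
  have gcont: "continuous_on ?K (\<lambda>p. g c (fst p))"
    by (rule continuous_on_compose2[OF continuous_on_subset[OF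
            smooth_map_on_imp_continuous_on[OF metricX(1)[OF c]] sub]]) (auto intro: continuous_intros)
  have repc: "continuous_on (rep_dom c d) (rep c d)"
    using holomorphic_map_onD(1)[OF holomorphic_rep[OF c d]]
    by (meson continuous_at_imp_continuous_on has_derivative_continuous)
  have hc: "continuous_on (rep_dom c d) (\<lambda>z. h d (rep c d z))"
    by (rule continuous_on_compose2[OF smooth_map_on_imp_continuous_on[OF metricY(1)[OF d]] repc rep_image[OF c]])
  have hcont: "continuous_on ?K (\<lambda>p. h d (rep c d (fst p)))"
    by (rule continuous_on_compose2[OF continuous_on_subset[OF hc r(2)]]) (auto intro: continuous_intros)
  have Dcont: "continuous_on ?K (\<lambda>p. frechet_derivative (rep c d) (at (fst p)) (snd p))"
    by (rule continuous_on_subset[OF continuous_on_holomorphic_derivative[OF open_rep_dom[OF c d] holomorphic_rep[OF c d]]])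
      (use r(2) in auto)
  have Ppos: "0 < ?P p" if "p \<in> ?K" for p
  proof (rule herm_norm2_pos[OF metricX(2)[OF c]])
    show "fst p \<in> snd c ` fst c" using that sub by auto
    show "snd p \<noteq> 0" using that by auto
  qed
  have cont: "continuous_on ?K (\<lambda>p. ?Q p / ?P p)"
    unfolding norm2_pullback_def
    by (intro continuous_on_divide continuous_on_herm_norm2 gcont hcont Dcont continuous_on_snd continuous_on_id)
      (use Ppos in fastforce)
  have comp: "compact ?K" by (intro compact_Times compact_cball compact_sphere)
  have ne: "?K \<noteq> {}"
  proof -
    obtain u :: "complex ^ 'm" where "norm u = 1" using vector_choose_size[of 1] by auto
    then have "(snd c x, u) \<in> ?K" using r(1) by simp
    then show ?thesis by blast
  qed
  from continuous_attains_sup[OF comp ne cont]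
  obtain p where p: "p \<in> ?K" "\<forall>q\<in>?K. ?Q q / ?P q \<le> ?Q p / ?P p" by (rule bexE)
  define T where "T = {y \<in> fst c. snd c y \<in> ball (snd c x) r}"
  show thesis
  proof
    show "openin X T" unfolding T_def by (rule openin_chart_vimage[OF chartX[OF c]]) simp
    show "x \<in> T" using x r by (simp add: T_def)
    show "T \<subseteq> fst c \<inter> f -` fst d"
    proof
      fix y assume y: "y \<in> T"
      then have "snd c y \<in> rep_dom c d" using r(2) unfolding T_def by auto
      then obtain w where "w \<in> fst c" "f w \<in> fst d" "snd c y = snd c w" unfolding rep_dom_def by auto
      moreover have "y \<in> fst c" using y by (simp add: T_def)
      ultimately have "y = w" using chart_inv_chart[OF chartX[OF c]] by metis
      then show "y \<in> fst c \<inter> f -` fst d" using \<open>w \<in> fst c\<close> \<open>f w \<in> fst d\<close> by simp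
    qed
    show "fst p \<in> rep_dom c d" "snd p \<noteq> 0" using p(1) r(2) by auto
    show "\<forall>y\<in>T. \<forall>u. norm2_pullback c d (snd c y) u \<le> ?Q p / ?P p * herm_norm2 (g c (snd c y)) u"
    proof (intro ballI allI)
      fix y u assume y: "y \<in> T"
      let ?z = "snd c y"
      have z: "?z \<in> cball (snd c x) r" using y unfolding T_def by auto
      then have zd: "?z \<in> rep_dom c d" using r(2) by blast
      show "norm2_pullback c d ?z u \<le> ?Q p / ?P p * herm_norm2 (g c ?z) u"
      proof (cases "u = 0")
        case True
        then show ?thesis
          using norm2_pullback_scaleR[OF c d zd, of 0 0] by (simp add: herm_norm2_zero)
      next
        case False
        define w where "w = (1 / norm u) *\<^sub>R u"
        have u: "u = norm u *\<^sub>R w" using False by (simp add: w_def)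
        have w: "(?z, w) \<in> ?K" using z False by (simp add: w_def)
        have "norm2_pullback c d ?z w \<le> ?Q p / ?P p * herm_norm2 (g c ?z) w"
          using bspec[OF p(2) w] Ppos[OF w] by (simp add: pos_divide_le_eq)
        then have "(norm u)\<^sup>2 * norm2_pullback c d ?z w \<le> (norm u)\<^sup>2 * (?Q p / ?P p * herm_norm2 (g c ?z) w)"
          by (intro mult_left_mono) simp_all
        then show ?thesis
          by (subst (1 2) u) (simp add: norm2_pullback_scaleR[OF c d zd] herm_norm2_scaleR mult_ac)
      qed
    qed
  qed
qed

lemma global_maximum:
  assumes "compact_space X" and ne: "topspace X \<noteq> {}"
  obtains c d z v where "c \<in> A" "d \<in> B" "z \<in> rep_dom c d" "v \<noteq> 0"
    and "\<forall>c'\<in>A. \<forall>d'\<in>B. \<forall>z'\<in>rep_dom c' d'. \<forall>u. norm2_pullback c' d' z' u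
      \<le> norm2_pullback c d z v / herm_norm2 (g c z) v * herm_norm2 (g c' z') u"
proof -
  \<comment> \<open>The bound \<open>\<rho>\<close> is recorded together with a vector attaining it.
    Thus the largest of finitely many bounds is again a value of the ratio and not merely an upper
    estimate.\<close>
  define good where "good T \<rho> \<longleftrightarrow> (\<exists>c\<in>A. \<exists>d\<in>B. T \<subseteq> fst c \<inter> f -` fst d \<and>
      (\<exists>z\<in>rep_dom c d. \<exists>v. v \<noteq> 0 \<and> \<rho> = norm2_pullback c d z v / herm_norm2 (g c z) v) \<and>
      (\<forall>y\<in>T. \<forall>u. norm2_pullback c d (snd c y) u \<le> \<rho> * herm_norm2 (g c (snd c y)) u))" for T \<rho>
  define \<U> where "\<U> = {T. openin X T \<and> (\<exists>\<rho>. good T \<rho>)}"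
  have "topspace X \<subseteq> \<Union>\<U>"
  proof
    fix x assume "x \<in> topspace X"
    then obtain c d where cd: "c \<in> A" "d \<in> B" "x \<in> fst c" "f x \<in> fst d" by (rule obtain_charts)
    obtain T z v where T: "openin X T" "x \<in> T" "T \<subseteq> fst c \<inter> f -` fst d" "z \<in> rep_dom c d" "v \<noteq> 0"
      "\<forall>y\<in>T. \<forall>u. norm2_pullback c d (snd c y) u
      \<le> norm2_pullback c d z v / herm_norm2 (g c z) v * herm_norm2 (g c (snd c y)) u"
      by (rule local_maximum[OF cd])
    have "good T (norm2_pullback c d z v / herm_norm2 (g c z) v)"
      unfolding good_def using cd T by blast
    then show "x \<in> \<Union>\<U>" using T(1,2) unfolding \<U>_def by blast
  qed
  moreover have "\<And>U. U \<in> \<U> \<Longrightarrow> openin X U" by (simp add: \<U>_def)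
  ultimately obtain \<F> where \<F>: "finite \<F>" "\<F> \<subseteq> \<U>" "topspace X \<subseteq> \<Union>\<F>"
    using assms(1) unfolding compact_space_alt by meson
  have "\<forall>T\<in>\<F>. \<exists>\<rho>. good T \<rho>" using \<F>(2) unfolding \<U>_def by blast
  then obtain \<rho> where \<rho>: "\<And>T. T \<in> \<F> \<Longrightarrow> good T (\<rho> T)" by metis
  have "\<F> \<noteq> {}" using ne \<F>(3) by blast
  then have "Max (\<rho> ` \<F>) \<in> \<rho> ` \<F>" using \<F>(1) by simp
  then obtain S where S: "S \<in> \<F>" "\<rho> S = Max (\<rho> ` \<F>)" by force
  have le: "\<rho> T \<le> \<rho> S" if "T \<in> \<F>" for T using that \<F>(1) S(2) by simp
  obtain c d z v where cd: "c \<in> A" "d \<in> B" "z \<in> rep_dom c d" "v \<noteq> 0"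
    "\<rho> S = norm2_pullback c d z v / herm_norm2 (g c z) v"
    using \<rho>[OF S(1)] unfolding good_def by blast
  show thesis
  proof (rule that[OF cd(1-4)], intro ballI allI)
    fix c' d' z' u assume c': "c' \<in> A" "d' \<in> B" "z' \<in> rep_dom c' d'"
    then obtain y where y: "y \<in> fst c'" "f y \<in> fst d'" "z' = snd c' y" unfolding rep_dom_def by auto
    have "y \<in> topspace X" using y(1) chartX[OF c'(1)] openin_subset unfolding is_chart_def by blast
    then obtain T where T: "T \<in> \<F>" "y \<in> T" using \<F>(3) by blast
    obtain c1 d1 where c1: "c1 \<in> A" "d1 \<in> B" "T \<subseteq> fst c1 \<inter> f -` fst d1"
      "\<And>u. norm2_pullback c1 d1 (snd c1 y) u \<le> \<rho> T * herm_norm2 (g c1 (snd c1 y)) u"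
      using \<rho>[OF T(1)] T(2) unfolding good_def by blast
    have y1: "y \<in> fst c1" "f y \<in> fst d1" using T(2) c1(3) by auto
    \<comment> \<open>The bound on \<open>T\<close> is known in the charts \<open>c1\<close>,
      \<open>d1\<close>, whereas \<open>z'\<close> and \<open>u\<close> are given in
      \<open>c'\<close>, \<open>d'\<close>; chart independence of both norms transfers it.\<close>
    obtain u' where u': "herm_norm2 (g c1 (snd c1 y)) u' = herm_norm2 (g c' z') u"
      "norm2_pullback c1 d1 (snd c1 y) u' = norm2_pullback c' d' z' u"
      using change_of_charts[OF c'(1) c1(1) c'(2) c1(2) y(1) y1(1) y(2) y1(2), of u]
      unfolding y(3) by blast
    have "norm2_pullback c' d' z' u \<le> \<rho> T * herm_norm2 (g c' z') u"
      using c1(4)[of u'] u' by simp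
    also have "\<dots> \<le> \<rho> S * herm_norm2 (g c' z') u"
    proof (rule mult_right_mono[OF le[OF T(1)]])
      have "z' \<in> snd c' ` fst c'" using c'(3) rep_dom_subset by blast
      then show "0 \<le> herm_norm2 (g c' z') u" by (intro herm_norm2_nonneg metricX(2) c'(1))
    qed
    finally show "norm2_pullback c' d' z' u
      \<le> norm2_pullback c d z v / herm_norm2 (g c z) v * herm_norm2 (g c' z') u" unfolding cd(5) .
  qed
qed

text \<open>A vanishing derivative makes the map constant on coordinate balls, hence locally
  constant; then its level sets are open and closed.\<close>

lemma constant_if_derivative_zero:
  assumes conn: "connected_space X"
    and zero: "\<And>c d z u. c \<in> A \<Longrightarrow> d \<in> B \<Longrightarrow> z \<in> rep_dom c d \<Longrightarrow> frechet_derivative (rep c d) (at z) u = 0"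
  shows "f constant_on topspace X"
proof -
  have loc: "\<exists>T. openin X T \<and> x \<in> T \<and> (\<forall>y\<in>T. f y = f x)" if "x \<in> topspace X" for x
  proof -
    from that obtain c d where cd: "c \<in> A" "d \<in> B" and x: "x \<in> fst c" "f x \<in> fst d"
      by (rule obtain_charts)
    have "snd c x \<in> rep_dom c d" using x unfolding rep_dom_def by auto
    then obtain r where r: "0 < r" "ball (snd c x) r \<subseteq> rep_dom c d"
      using open_rep_dom[OF cd] open_contains_ball by blast
    have "\<exists>k. \<forall>z\<in>ball (snd c x) r. rep c d z = k"
    proof (rule has_derivative_zero_constant)
      fix z assume "z \<in> ball (snd c x) r"
      then have z: "z \<in> rep_dom c d" using r by blast
      have "frechet_derivative (rep c d) (at z) = (\<lambda>h. 0)" using zero[OF cd z] by auto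
      then show "(rep c d has_derivative (\<lambda>h. 0)) (at z within ball (snd c x) r)"
        using holomorphic_map_onD(1)[OF holomorphic_rep[OF cd] z] has_derivative_at_withinI by metis
    qed simp
    then obtain k where k: "\<And>z. z \<in> ball (snd c x) r \<Longrightarrow> rep c d z = k" by blast
    define T where "T = {y \<in> fst c. snd c y \<in> ball (snd c x) r} \<inter> (fst c \<inter> f -` fst d)"
    have "openin X T" unfolding T_def
      by (intro openin_Int openin_chart_vimage[OF chartX[OF cd(1)]] openin_preimage)
        (use chartX[OF cd(1)] chartY[OF cd(2)] in \<open>auto simp: is_chart_def\<close>)
    moreover have "x \<in> T" using x r by (auto simp: T_def)
    moreover have "f y = f x" if "y \<in> T" for y
    proof -
      have y: "y \<in> fst c" "f y \<in> fst d" "snd c y \<in> ball (snd c x) r" using that unfolding T_def by auto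
      have "snd d (f y) = snd d (f x)"
        using k[OF y(3)] k[of "snd c x"] r(1) rep_chart[OF cd(1) y(1)] rep_chart[OF cd(1) x(1)] by simp
      then show ?thesis using chart_inv_chart[OF chartY[OF cd(2)]] y(2) x(2) by metis
    qed
    ultimately show ?thesis by blast
  qed
  show ?thesis
  proof (cases "topspace X = {}")
    case True
    then show ?thesis by (simp add: constant_on_def)
  next
    case False
    then obtain x0 where x0: "x0 \<in> topspace X" by blast
    let ?S = "{x \<in> topspace X. f x = f x0}"
    \<comment> \<open>For a locally constant map every condition on the value is an open condition;
      applied to equality it gives \<open>?S\<close>, applied to inequality the complement.\<close>
    have op: "openin X {x \<in> topspace X. R (f x)}" for R
    proof (rule openin_subopen[THEN iffD2], intro ballI)
      fix x assume x: "x \<in> {x \<in> topspace X. R (f x)}"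
      then obtain T where T: "openin X T" "x \<in> T" "\<forall>y\<in>T. f y = f x" using loc by blast
      have "R (f y)" if "y \<in> T" for y using bspec[OF T(3) that] x by simp
      then have "T \<subseteq> {x \<in> topspace X. R (f x)}" using openin_subset[OF T(1)] by blast
      then show "\<exists>T. openin X T \<and> x \<in> T \<and> T \<subseteq> {x \<in> topspace X. R (f x)}" using T by blast
    qed
    have "topspace X - ?S = {x \<in> topspace X. f x \<noteq> f x0}" by blast
    then have "closedin X ?S" using op[of "\<lambda>y. y \<noteq> f x0"] by (simp add: closedin_def)
    moreover have "openin X ?S" by (rule op)
    ultimately have "?S = topspace X"
      using conn x0 unfolding connected_space_clopen_in by blast
    then show ?thesis unfolding constant_on_def by blast
  qed
qed

text \<open>Here \<open>p\<close> and \<open>q\<close> are the squared norms of \<open>v\<close> and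
  of its image \<open>w\<close>. Their positivity is what transfers the signs of the curvatures to
  the two sides.\<close>

lemma nonconstant_curvature_inequality:
  assumes "compact_space X" and "connected_space X" and nc: "\<not> f constant_on topspace X"
  obtains c d z v w p q where "c \<in> A" "d \<in> B" "z \<in> snd c ` fst c" "rep c d z \<in> snd d ` fst d"
    and "v \<noteq> 0" "w \<noteq> 0" "0 < p" "0 < (q::real)"
    and "hol_sect_curv (g c) z v * p \<le> hol_sect_curv (h d) (rep c d z) w * q"
proof -
  have "topspace X \<noteq> {}" using nc by (auto simp: constant_on_def)
  then obtain c d z v where cd: "c \<in> A" "d \<in> B" and z: "z \<in> rep_dom c d" and v: "v \<noteq> 0"
    and max: "\<forall>c'\<in>A. \<forall>d'\<in>B. \<forall>z'\<in>rep_dom c' d'. \<forall>u. norm2_pullback c' d' z' u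
      \<le> norm2_pullback c d z v / herm_norm2 (g c z) v * herm_norm2 (g c' z') u"
    by (rule global_maximum[OF assms(1)])
  let ?w = "frechet_derivative (rep c d) (at z) v"
  have zc: "z \<in> snd c ` fst c" and rz: "rep c d z \<in> snd d ` fst d"
    using z rep_dom_subset rep_image[OF cd(1)] by blast+
  have p: "0 < herm_norm2 (g c z) v" by (rule herm_norm2_pos[OF metricX(2)[OF cd(1) zc] v])
  \<comment> \<open>If the maximizing vector were killed, the maximal ratio would be 0, every
    differential would vanish by definiteness of the target metric, and the map would be
    constant.\<close>
  have w: "?w \<noteq> 0"
  proof
    assume "?w = 0"
    then have 0: "norm2_pullback c d z v = 0" by (simp add: norm2_pullback_def herm_norm2_zero)
    have "frechet_derivative (rep c' d') (at z') u = 0" if "c' \<in> A" "d' \<in> B" "z' \<in> rep_dom c' d'" for c' d' z' u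
    proof (rule ccontr)
      assume "frechet_derivative (rep c' d') (at z') u \<noteq> 0"
      moreover have "rep c' d' z' \<in> snd d' ` fst d'" using that rep_image by blast
      ultimately have "0 < norm2_pullback c' d' z' u"
        unfolding norm2_pullback_def by (intro herm_norm2_pos metricY(2) that)
      then show False using max[rule_format, OF that, of u] 0 by simp
    qed
    then show False using constant_if_derivative_zero[OF assms(2)] nc by blast
  qed
  have q: "0 < herm_norm2 (h d (rep c d z)) ?w" by (rule herm_norm2_pos[OF metricY(2)[OF cd(2) rz] w])
  have "hol_sect_curv (g c) z v * herm_norm2 (g c z) v
      \<le> hol_sect_curv (h d) (rep c d z) ?w * herm_norm2 (h d (rep c d z)) ?w"
  proof (rule schwarz_at_maximum[OF open_rep_dom[OF cd] smooth_map_on_subset[OF metricX(1)[OF cd(1)] rep_dom_subset]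
        metricX(2)[OF cd(1) subsetD[OF rep_dom_subset]] _ metricY[OF cd(2)]
        holomorphic_rep[OF cd] rep_image[OF cd(1)] z v w])
    show "open (snd d ` fst d)" using chartY[OF cd(2)] by (simp add: is_chart_def)
    fix z' u assume z': "z' \<in> rep_dom c d"
    show "herm_norm2 (h d (rep c d z')) (frechet_derivative (rep c d) (at z') u) * herm_norm2 (g c z) v
      \<le> herm_norm2 (h d (rep c d z)) ?w * herm_norm2 (g c z') u"
      using max[rule_format, OF cd z', of u] p by (simp add: norm2_pullback_def field_simps)
  qed
  then show thesis using that[OF cd zc rz v w p q] by blast
qed

end

theorem corollary1p6:
  fixes X :: "'a topology" and A :: "('a, 'm::finite) chart set"
    and g :: "('a, 'm) chart \<Rightarrow> complex ^ 'm \<Rightarrow> complex ^ 'm ^ 'm"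
    and Y :: "'b topology" and B :: "('b, 'n::finite) chart set"
    and h :: "('b, 'n) chart \<Rightarrow> complex ^ 'n \<Rightarrow> complex ^ 'n ^ 'n"
  assumes "hermitian_manifold X A g" and "compact_space X" and "connected_space X"
    and "hermitian_manifold Y B h"
  shows "(hol_sect_curv_cond (\<lambda>H. 0 < H) A g \<and> hol_sect_curv_cond (\<lambda>H. H \<le> 0) B h \<longrightarrow>
            \<not> (\<exists>f. holomorphic_map X A Y B f \<and> \<not> f constant_on topspace X)) \<and>
         (hol_sect_curv_cond (\<lambda>H. 0 \<le> H) A g \<and> hol_sect_curv_cond (\<lambda>H. H < 0) B h \<longrightarrow>
            \<not> (\<exists>f. holomorphic_map X A Y B f \<and> \<not> f constant_on topspace X))"
proof -
  \<comment> \<open>One inequality serves both claims: the curvature conditions place its left side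
    at or above 0 and its right side at or below 0, with strictness on the source side in one claim
    and on the target side in the other.\<close>
  have *: "\<exists>c\<in>A. \<exists>d\<in>B. \<exists>z\<in>snd c ` fst c. \<exists>z'\<in>snd d ` fst d. \<exists>v w p q. v \<noteq> 0 \<and> w \<noteq> 0 \<and>
      0 < p \<and> 0 < q \<and> hol_sect_curv (g c) z v * p \<le> hol_sect_curv (h d) z' w * q"
    if f: "holomorphic_map X A Y B f" and nc: "\<not> f constant_on topspace X" for f
  proof -
    interpret hermitian_holomorphic_map X A g Y B h f
      using assms f by unfold_locales
    show ?thesis
      by (rule nonconstant_curvature_inequality[OF assms(2,3) nc]) blast
  qed
  show ?thesis
  proof (intro conjI impI notI; elim conjE exE)
    fix f assume H: "hol_sect_curv_cond (\<lambda>H. 0 < H) A g" "hol_sect_curv_cond (\<lambda>H. H \<le> 0) B h"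
      and "holomorphic_map X A Y B f" "\<not> f constant_on topspace X"
    from *[OF this(3,4)] obtain c d z z' v w p q
      where 1: "c \<in> A" "d \<in> B" "z \<in> snd c ` fst c" "z' \<in> snd d ` fst d" "v \<noteq> 0" "w \<noteq> 0" "0 < p" "0 < q"
        "hol_sect_curv (g c) z v * p \<le> hol_sect_curv (h d) z' w * q" by blast
    have "0 < hol_sect_curv (g c) z v" "hol_sect_curv (h d) z' w \<le> 0"
      using H 1 unfolding hol_sect_curv_cond_def by blast+
    then have "0 < hol_sect_curv (g c) z v * p" "hol_sect_curv (h d) z' w * q \<le> 0"
      using 1 by (simp_all add: mult_nonpos_nonneg)
    then show False using 1 by linarith
  next
    fix f assume H: "hol_sect_curv_cond (\<lambda>H. 0 \<le> H) A g" "hol_sect_curv_cond (\<lambda>H. H < 0) B h"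
      and "holomorphic_map X A Y B f" "\<not> f constant_on topspace X"
    from *[OF this(3,4)] obtain c d z z' v w p q
      where 1: "c \<in> A" "d \<in> B" "z \<in> snd c ` fst c" "z' \<in> snd d ` fst d" "v \<noteq> 0" "w \<noteq> 0" "0 < p" "0 < q"
        "hol_sect_curv (g c) z v * p \<le> hol_sect_curv (h d) z' w * q" by blast
    have "0 \<le> hol_sect_curv (g c) z v" "hol_sect_curv (h d) z' w < 0"
      using H 1 unfolding hol_sect_curv_cond_def by blast+
    then have "0 \<le> hol_sect_curv (g c) z v * p" "hol_sect_curv (h d) z' w * q < 0"
      using 1 by (simp_all add: mult_neg_pos)
    then show False using 1 by linarith
  qed
qed

end
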